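(* Let $\mathbb{C}$ be an exact category satisfying Condition P. Then every monomorphism in $\mathbb{C}$ is a regular monomorphism, and $\mathbb{C}$ is balanced. If, in addition, $\mathbb{C}$ admits pushouts of regular epimorphisms along regular epimorphisms, then $\mathbb{C}$ is coregular.
   Context: A category is regular if it is finitely complete, admits coequalizers of kernel pairs, and its regular epimorphisms are pullback stable. A regular category is exact (in the sense of Barr) if every internal equivalence relation in it is effective, i.e. is the kernel pair of some morphism. A category is coregular if its opposite category is regular. A category is balanced if every morphism that is both a monomorphism and an epimorphism is an isomorphism. A feeble pullback in a category with finite limits is a commutative square such that the unique induced morphism from its initial corner into the pullback is a regular epimorphism. A category $\mathbb{C}$ with finite limits is said to satisfy Condition P if: (a) finite coproducts exist in $\mathbb{C}$; (b) binary coproducts of pullback squares are pullback squares in $\mathbb{C}$ (that is, given two pullback squares, the square obtained by taking the binary coproduct of corresponding objects and morphisms is a pullback); (c) for each monomorphism $m:S\to A$ in $\mathbb{C}$, the commutative square with top $m+1_S:S+S\to A+S$, left side $[1_S,1_S]:S+S\to S$, right side $[1_A,m]:A+S\to A$ and bottom $m:S\to A$ is a pullback; (d) for each regular epimorphism $p:E\to B$ in $\mathbb{C}$, the commutative square with top $p+p:E+E\to B+B$, left side $[1_E,1_E]:E+E\to E$, right side $[1_B,1_B]:B+B\to B$ and bottom $p:E\to B$ is a feeble pullback. *)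

theory Defs
  imports Main
begin

section \<open>Categories\<close>

record ('o, 'a) cat =
  Ob :: "'o set"
  Ar :: "'a set"
  Dom :: "'a \<Rightarrow> 'o"
  Cod :: "'a \<Rightarrow> 'o"
  Id :: "'o \<Rightarrow> 'a"
  Comp :: "'a \<Rightarrow> 'a \<Rightarrow> 'a"  (infixl "\<cdot>\<index>" 70)

text \<open>Composition is in applicative order: \<open>g \<cdot> f\<close> is ``first \<open>f\<close>, then \<open>g\<close>''.\<close>

definition Hom :: "('o, 'a) cat \<Rightarrow> 'o \<Rightarrow> 'o \<Rightarrow> 'a set" where
  "Hom C A B = {f \<in> Ar C. Dom C f = A \<and> Cod C f = B}"

locale category =
  fixes C :: "('o, 'a) cat" (structure)
  assumes Dom_Ob: "f \<in> Ar C \<Longrightarrow> Dom C f \<in> Ob C"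
    and Cod_Ob: "f \<in> Ar C \<Longrightarrow> Cod C f \<in> Ob C"
    and Id_Hom: "A \<in> Ob C \<Longrightarrow> Id C A \<in> Hom C A A"
    and Comp_Hom: "f \<in> Hom C A B \<Longrightarrow> g \<in> Hom C B D \<Longrightarrow> g \<cdot> f \<in> Hom C A D"
    and Comp_Id: "f \<in> Hom C A B \<Longrightarrow> f \<cdot> Id C A = f"
    and Id_Comp: "f \<in> Hom C A B \<Longrightarrow> Id C B \<cdot> f = f"
    and Comp_assoc: "f \<in> Hom C A B \<Longrightarrow> g \<in> Hom C B D \<Longrightarrow> h \<in> Hom C D E \<Longrightarrow>
      h \<cdot> (g \<cdot> f) = (h \<cdot> g) \<cdot> f"

definition opp :: "('o, 'a) cat \<Rightarrow> ('o, 'a) cat" where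
  "opp C = \<lparr>Ob = Ob C, Ar = Ar C, Dom = Cod C, Cod = Dom C, Id = Id C,
            Comp = (\<lambda>g f. f \<cdot>\<^bsub>C\<^esub> g)\<rparr>"

definition is_mono :: "('o, 'a) cat \<Rightarrow> 'a \<Rightarrow> bool" where
  "is_mono C m \<longleftrightarrow> m \<in> Ar C \<and>
     (\<forall>X. \<forall>f \<in> Hom C X (Dom C m). \<forall>g \<in> Hom C X (Dom C m).
        m \<cdot>\<^bsub>C\<^esub> f = m \<cdot>\<^bsub>C\<^esub> g \<longrightarrow> f = g)"

definition is_epi :: "('o, 'a) cat \<Rightarrow> 'a \<Rightarrow> bool" where
  "is_epi C e \<longleftrightarrow> is_mono (opp C) e"

definition is_iso :: "('o, 'a) cat \<Rightarrow> 'a \<Rightarrow> bool" where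
  "is_iso C f \<longleftrightarrow> f \<in> Ar C \<and>
     (\<exists>g \<in> Hom C (Cod C f) (Dom C f).
        g \<cdot>\<^bsub>C\<^esub> f = Id C (Dom C f) \<and> f \<cdot>\<^bsub>C\<^esub> g = Id C (Cod C f))"

definition balanced :: "('o, 'a) cat \<Rightarrow> bool" where
  "balanced C \<longleftrightarrow> (\<forall>f. is_mono C f \<and> is_epi C f \<longrightarrow> is_iso C f)"


section \<open>Limits and colimits\<close>

definition is_equalizer :: "('o, 'a) cat \<Rightarrow> 'a \<Rightarrow> 'a \<Rightarrow> 'a \<Rightarrow> bool" where
  "is_equalizer C e f g \<longleftrightarrow>
     (\<exists>A B. f \<in> Hom C A B \<and> g \<in> Hom C A B \<and> e \<in> Hom C (Dom C e) A) \<and>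
     f \<cdot>\<^bsub>C\<^esub> e = g \<cdot>\<^bsub>C\<^esub> e \<and>
     (\<forall>X. \<forall>h \<in> Hom C X (Cod C e). f \<cdot>\<^bsub>C\<^esub> h = g \<cdot>\<^bsub>C\<^esub> h \<longrightarrow>
        (\<exists>!u. u \<in> Hom C X (Dom C e) \<and> e \<cdot>\<^bsub>C\<^esub> u = h))"

definition is_coequalizer :: "('o, 'a) cat \<Rightarrow> 'a \<Rightarrow> 'a \<Rightarrow> 'a \<Rightarrow> bool" where
  "is_coequalizer C q f g \<longleftrightarrow> is_equalizer (opp C) q f g"

definition regular_mono :: "('o, 'a) cat \<Rightarrow> 'a \<Rightarrow> bool" where
  "regular_mono C m \<longleftrightarrow> (\<exists>f g. is_equalizer C m f g)"

definition regular_epi :: "('o, 'a) cat \<Rightarrow> 'a \<Rightarrow> bool" where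
  "regular_epi C e \<longleftrightarrow> (\<exists>f g. is_coequalizer C e f g)"

text \<open>Squares are given by their sides, in the order top, left, right, bottom:

  \<open>t : P \<rightarrow> A\<close>, \<open>l : P \<rightarrow> B\<close>, \<open>r : A \<rightarrow> D\<close>, \<open>b : B \<rightarrow> D\<close>.\<close>

definition comm_square :: "('o, 'a) cat \<Rightarrow> 'a \<Rightarrow> 'a \<Rightarrow> 'a \<Rightarrow> 'a \<Rightarrow> bool" where
  "comm_square C t l r b \<longleftrightarrow>
     (\<exists>P A B D. t \<in> Hom C P A \<and> l \<in> Hom C P B \<and> r \<in> Hom C A D \<and> b \<in> Hom C B D) \<and>
     r \<cdot>\<^bsub>C\<^esub> t = b \<cdot>\<^bsub>C\<^esub> l"

definition is_pullback :: "('o, 'a) cat \<Rightarrow> 'a \<Rightarrow> 'a \<Rightarrow> 'a \<Rightarrow> 'a \<Rightarrow> bool" where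
  "is_pullback C t l r b \<longleftrightarrow> comm_square C t l r b \<and>
     (\<forall>x y. comm_square C x y r b \<longrightarrow>
        (\<exists>!u. u \<in> Hom C (Dom C x) (Dom C t) \<and> t \<cdot>\<^bsub>C\<^esub> u = x \<and> l \<cdot>\<^bsub>C\<^esub> u = y))"

text \<open>A pushout of the span \<open>(t, l)\<close> is the cospan \<open>(r, b)\<close>; reversing arrows
  turns the square with sides \<open>t, l, r, b\<close> into the one with sides \<open>r, b, t, l\<close>.\<close>

definition is_pushout :: "('o, 'a) cat \<Rightarrow> 'a \<Rightarrow> 'a \<Rightarrow> 'a \<Rightarrow> 'a \<Rightarrow> bool" where
  "is_pushout C t l r b \<longleftrightarrow> is_pullback (opp C) r b t l"

definition is_kernel_pair :: "('o, 'a) cat \<Rightarrow> 'a \<Rightarrow> 'a \<Rightarrow> 'a \<Rightarrow> bool" where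
  "is_kernel_pair C p q f \<longleftrightarrow> is_pullback C p q f f"

definition is_feeble_pullback :: "('o, 'a) cat \<Rightarrow> 'a \<Rightarrow> 'a \<Rightarrow> 'a \<Rightarrow> 'a \<Rightarrow> bool" where
  "is_feeble_pullback C t l r b \<longleftrightarrow> comm_square C t l r b \<and>
     (\<exists>x y u. is_pullback C x y r b \<and> u \<in> Hom C (Dom C t) (Dom C x) \<and>
        x \<cdot>\<^bsub>C\<^esub> u = t \<and> y \<cdot>\<^bsub>C\<^esub> u = l \<and> regular_epi C u)"

definition is_functor ::
  "('i, 'j) cat \<Rightarrow> ('o, 'a) cat \<Rightarrow> ('i \<Rightarrow> 'o) \<Rightarrow> ('j \<Rightarrow> 'a) \<Rightarrow> bool" where
  "is_functor J C Fo Fa \<longleftrightarrow>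
     (\<forall>i \<in> Ob J. Fo i \<in> Ob C \<and> Fa (Id J i) = Id C (Fo i)) \<and>
     (\<forall>u \<in> Ar J. Fa u \<in> Hom C (Fo (Dom J u)) (Fo (Cod J u))) \<and>
     (\<forall>u \<in> Ar J. \<forall>v \<in> Ar J. Cod J u = Dom J v \<longrightarrow>
        Fa (v \<cdot>\<^bsub>J\<^esub> u) = Fa v \<cdot>\<^bsub>C\<^esub> Fa u)"

definition is_cone ::
  "('i, 'j) cat \<Rightarrow> ('o, 'a) cat \<Rightarrow> ('i \<Rightarrow> 'o) \<Rightarrow> ('j \<Rightarrow> 'a) \<Rightarrow> 'o \<Rightarrow> ('i \<Rightarrow> 'a) \<Rightarrow> bool" where
  "is_cone J C Fo Fa L c \<longleftrightarrow> L \<in> Ob C \<and>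
     (\<forall>i \<in> Ob J. c i \<in> Hom C L (Fo i)) \<and>
     (\<forall>u \<in> Ar J. Fa u \<cdot>\<^bsub>C\<^esub> c (Dom J u) = c (Cod J u))"

definition is_limit ::
  "('i, 'j) cat \<Rightarrow> ('o, 'a) cat \<Rightarrow> ('i \<Rightarrow> 'o) \<Rightarrow> ('j \<Rightarrow> 'a) \<Rightarrow> 'o \<Rightarrow> ('i \<Rightarrow> 'a) \<Rightarrow> bool" where
  "is_limit J C Fo Fa L c \<longleftrightarrow> is_cone J C Fo Fa L c \<and>
     (\<forall>X d. is_cone J C Fo Fa X d \<longrightarrow>
        (\<exists>!u. u \<in> Hom C X L \<and> (\<forall>i \<in> Ob J. c i \<cdot>\<^bsub>C\<^esub> u = d i)))"

text \<open>Every finite category is isomorphic to one whose objects and arrows are natural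
  numbers, so it is enough to let the shapes range over those.\<close>

definition finitely_complete :: "('o, 'a) cat \<Rightarrow> bool" where
  "finitely_complete C \<longleftrightarrow>
     (\<forall>(J :: (nat, nat) cat) Fo Fa.
        category J \<and> finite (Ob J) \<and> finite (Ar J) \<and> is_functor J C Fo Fa \<longrightarrow>
        (\<exists>L c. is_limit J C Fo Fa L c))"

definition has_finite_products :: "('o, 'a) cat \<Rightarrow> bool" where
  "has_finite_products C \<longleftrightarrow>
     (\<forall>(I :: nat set) X. finite I \<and> (\<forall>i \<in> I. X i \<in> Ob C) \<longrightarrow>
        (\<exists>P \<in> Ob C. \<exists>p. (\<forall>i \<in> I. p i \<in> Hom C P (X i)) \<and>
           (\<forall>Y \<in> Ob C. \<forall>f. (\<forall>i \<in> I. f i \<in> Hom C Y (X i)) \<longrightarrow>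
              (\<exists>!u. u \<in> Hom C Y P \<and> (\<forall>i \<in> I. p i \<cdot>\<^bsub>C\<^esub> u = f i)))))"

definition has_finite_coproducts :: "('o, 'a) cat \<Rightarrow> bool" where
  "has_finite_coproducts C \<longleftrightarrow> has_finite_products (opp C)"


section \<open>Binary coproducts\<close>

definition is_product :: "('o, 'a) cat \<Rightarrow> 'o \<Rightarrow> 'o \<Rightarrow> 'a \<Rightarrow> 'a \<Rightarrow> bool" where
  "is_product C A B p q \<longleftrightarrow>
     (\<exists>P. p \<in> Hom C P A \<and> q \<in> Hom C P B) \<and>
     (\<forall>X. \<forall>f \<in> Hom C X A. \<forall>g \<in> Hom C X B.
        \<exists>!u. u \<in> Hom C X (Dom C p) \<and> p \<cdot>\<^bsub>C\<^esub> u = f \<and> q \<cdot>\<^bsub>C\<^esub> u = g)"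

definition is_coproduct :: "('o, 'a) cat \<Rightarrow> 'o \<Rightarrow> 'o \<Rightarrow> 'a \<Rightarrow> 'a \<Rightarrow> bool" where
  "is_coproduct C A B i j \<longleftrightarrow> is_product (opp C) A B i j"

text \<open>When binary coproducts exist, a coproduct \<open>A + B\<close> is chosen for each pair of
  objects. The conditions imposed below are invariant under isomorphism and hence do not
  depend on the choice.\<close>

definition coproj :: "('o, 'a) cat \<Rightarrow> 'o \<Rightarrow> 'o \<Rightarrow> 'a \<times> 'a" where
  "coproj C A B = (SOME ij. is_coproduct C A B (fst ij) (snd ij))"

definition inl :: "('o, 'a) cat \<Rightarrow> 'o \<Rightarrow> 'o \<Rightarrow> 'a" where
  "inl C A B = fst (coproj C A B)"

definition inr :: "('o, 'a) cat \<Rightarrow> 'o \<Rightarrow> 'o \<Rightarrow> 'a" where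
  "inr C A B = snd (coproj C A B)"

definition coprod :: "('o, 'a) cat \<Rightarrow> 'o \<Rightarrow> 'o \<Rightarrow> 'o" where
  "coprod C A B = Cod C (inl C A B)"

text \<open>\<open>copair C f g\<close> is \<open>[f, g] : A + B \<rightarrow> X\<close> for \<open>f : A \<rightarrow> X\<close> and \<open>g : B \<rightarrow> X\<close>.\<close>

definition copair :: "('o, 'a) cat \<Rightarrow> 'a \<Rightarrow> 'a \<Rightarrow> 'a" where
  "copair C f g =
     (THE h. h \<in> Hom C (coprod C (Dom C f) (Dom C g)) (Cod C f) \<and>
        h \<cdot>\<^bsub>C\<^esub> inl C (Dom C f) (Dom C g) = f \<and>
        h \<cdot>\<^bsub>C\<^esub> inr C (Dom C f) (Dom C g) = g)"

text \<open>\<open>coprod_map C f g\<close> is \<open>f + g : A + B \<rightarrow> A' + B'\<close> for \<open>f : A \<rightarrow> A'\<close> and \<open>g : B \<rightarrow> B'\<close>.\<close>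

definition coprod_map :: "('o, 'a) cat \<Rightarrow> 'a \<Rightarrow> 'a \<Rightarrow> 'a" where
  "coprod_map C f g =
     copair C (inl C (Cod C f) (Cod C g) \<cdot>\<^bsub>C\<^esub> f) (inr C (Cod C f) (Cod C g) \<cdot>\<^bsub>C\<^esub> g)"


section \<open>Regular, exact and coregular categories\<close>

locale regular_category = category +
  assumes finitely_complete: "finitely_complete C"
    and kernel_pair_coequalizer: "is_kernel_pair C p q f \<Longrightarrow> \<exists>e. is_coequalizer C e p q"
    and regular_epi_stable: "is_pullback C t l r b \<Longrightarrow> regular_epi C r \<Longrightarrow> regular_epi C l"

definition internal_equivalence :: "('o, 'a) cat \<Rightarrow> 'o \<Rightarrow> 'a \<Rightarrow> 'a \<Rightarrow> bool" where
  "internal_equivalence C A d1 d2 \<longleftrightarrow>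
     (\<exists>R. d1 \<in> Hom C R A \<and> d2 \<in> Hom C R A \<and>
        \<comment> \<open>jointly monic\<close>
        (\<forall>X. \<forall>f \<in> Hom C X R. \<forall>g \<in> Hom C X R.
           d1 \<cdot>\<^bsub>C\<^esub> f = d1 \<cdot>\<^bsub>C\<^esub> g \<and> d2 \<cdot>\<^bsub>C\<^esub> f = d2 \<cdot>\<^bsub>C\<^esub> g \<longrightarrow> f = g) \<and>
        \<comment> \<open>reflexive\<close>
        (\<exists>r \<in> Hom C A R. d1 \<cdot>\<^bsub>C\<^esub> r = Id C A \<and> d2 \<cdot>\<^bsub>C\<^esub> r = Id C A) \<and>
        \<comment> \<open>symmetric\<close>
        (\<exists>s \<in> Hom C R R. d1 \<cdot>\<^bsub>C\<^esub> s = d2 \<and> d2 \<cdot>\<^bsub>C\<^esub> s = d1) \<and>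
        \<comment> \<open>transitive; \<open>p, q\<close> are the projections of \<open>R \<times>\<^bsub>A\<^esub> R\<close>, which exists in a regular category\<close>
        (\<forall>p q. is_pullback C p q d2 d1 \<longrightarrow>
           (\<exists>t \<in> Hom C (Dom C p) R.
              d1 \<cdot>\<^bsub>C\<^esub> t = d1 \<cdot>\<^bsub>C\<^esub> p \<and> d2 \<cdot>\<^bsub>C\<^esub> t = d2 \<cdot>\<^bsub>C\<^esub> q)))"

locale exact_category = regular_category +
  assumes effective: "internal_equivalence C A d1 d2 \<Longrightarrow> \<exists>f. is_kernel_pair C d1 d2 f"

definition coregular_category :: "('o, 'a) cat \<Rightarrow> bool" where
  "coregular_category C \<longleftrightarrow> regular_category (opp C)"


section \<open>Condition P\<close>

definition condition_P :: "('o, 'a) cat \<Rightarrow> bool" where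
  "condition_P C \<longleftrightarrow>
     has_finite_coproducts C \<and>
     (\<forall>t l r b t' l' r' b'.
        is_pullback C t l r b \<and> is_pullback C t' l' r' b' \<longrightarrow>
        is_pullback C (coprod_map C t t') (coprod_map C l l')
          (coprod_map C r r') (coprod_map C b b')) \<and>
     (\<forall>S A m. is_mono C m \<and> m \<in> Hom C S A \<longrightarrow>
        is_pullback C (coprod_map C m (Id C S)) (copair C (Id C S) (Id C S))
          (copair C (Id C A) m) m) \<and>
     (\<forall>E B p. regular_epi C p \<and> p \<in> Hom C E B \<longrightarrow>
        is_feeble_pullback C (coprod_map C p p) (copair C (Id C E) (Id C E))
          (copair C (Id C B) (Id C B)) p)"

definition pushouts_of_regular_epis :: "('o, 'a) cat \<Rightarrow> bool" where
  "pushouts_of_regular_epis C \<longleftrightarrow>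
     (\<forall>f g. regular_epi C f \<and> regular_epi C g \<and> Dom C f = Dom C g \<longrightarrow>
        (\<exists>r b. is_pushout C f g r b))"

end

theory Submission
  imports Defs
begin

text \<open>
  Let \<open>m : S \<rightarrow> A\<close> be a monomorphism, \<open>p : S \<rightarrow> B\<close> a regular epimorphism and \<open>k1, k2 : K \<rightarrow> S\<close> the
  kernel pair of \<open>p\<close>. The image \<open>R\<close> of \<open>([1, m k1], [1, m k2]) : A + K \<rightarrow> A \<times> A\<close> is an equivalence
  relation. For transitivity, Condition P (b)--(d) shows that the pullback of \<open>[1, m k2]\<close> and
  \<open>[1, m k1]\<close> is covered by \<open>A + K + K + K \<times>\<^sub>S K\<close>, on whose summands the composite visibly lies
  in \<open>R\<close>. Exactness makes \<open>R\<close> the kernel pair of some \<open>q\<close>, and \<open>q m = n p\<close> for a unique \<open>n\<close>;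
  by (b) and (c), \<open>n\<close> is a monomorphism and the square is a pullback. It need not be a pushout.

  For arbitrary \<open>f : S \<rightarrow> B\<close>, apply this to \<open>m + 1 : S + B \<rightarrow> A + B\<close> and the split epimorphism
  \<open>[f, 1] : S + B \<rightarrow> B\<close>: the span \<open>(m, f)\<close> is completed to a pullback square with \<open>n\<close> opposite
  to \<open>m\<close> monic. The case \<open>f = m\<close> presents \<open>m\<close> as an equalizer, and comparison with a pushout of
  \<open>(m, f)\<close> shows that monomorphisms are stable under pushout. Finally, a coequalizer of
  \<open>f, g : A \<rightarrow> B\<close> is a pushout of the split epimorphisms \<open>[f, 1], [g, 1] : A + B \<rightarrow> B\<close>.
\<close>

section \<open>Opposite categories, monomorphisms, equalizers, coequalizers and pullbacks\<close>

declare Hom_def [simp]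

lemma opp_simps [simp]:
  "Ob (opp C) = Ob C" "Ar (opp C) = Ar C" "Dom (opp C) = Cod C" "Cod (opp C) = Dom C"
  "Id (opp C) = Id C" "g \<cdot>\<^bsub>opp C\<^esub> f = f \<cdot>\<^bsub>C\<^esub> g"
  by (simp_all add: opp_def)

lemma Hom_opp: "Hom (opp C) A B = Hom C B A"
  by auto

lemma opp_opp [simp]: "opp (opp C) = C"
  by (simp add: opp_def)

context category
begin

lemma comp_Ar [simp]: "f \<in> Ar C \<Longrightarrow> g \<in> Ar C \<Longrightarrow> Dom C g = Cod C f \<Longrightarrow> g \<cdot> f \<in> Ar C"
  and dom_comp [simp]: "f \<in> Ar C \<Longrightarrow> g \<in> Ar C \<Longrightarrow> Dom C g = Cod C f \<Longrightarrow> Dom C (g \<cdot> f) = Dom C f"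
  and cod_comp [simp]: "f \<in> Ar C \<Longrightarrow> g \<in> Ar C \<Longrightarrow> Dom C g = Cod C f \<Longrightarrow> Cod C (g \<cdot> f) = Cod C g"
  using Comp_Hom[of f "Dom C f" "Cod C f" g "Cod C g"] by simp_all

lemma assoc [simp]:
  "f \<in> Ar C \<Longrightarrow> g \<in> Ar C \<Longrightarrow> h \<in> Ar C \<Longrightarrow> Dom C g = Cod C f \<Longrightarrow> Dom C h = Cod C g \<Longrightarrow>
    (h \<cdot> g) \<cdot> f = h \<cdot> (g \<cdot> f)"
  using Comp_assoc[of f "Dom C f" "Cod C f" g "Cod C g" h "Cod C h"] by simp

lemma Id_Ar [simp]: "A \<in> Ob C \<Longrightarrow> Id C A \<in> Ar C"
  and dom_Id [simp]: "A \<in> Ob C \<Longrightarrow> Dom C (Id C A) = A"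
  and cod_Id [simp]: "A \<in> Ob C \<Longrightarrow> Cod C (Id C A) = A"
  using Id_Hom[of A] by simp_all

lemma comp_Id [simp]: "f \<in> Ar C \<Longrightarrow> Dom C f = A \<Longrightarrow> f \<cdot> Id C A = f"
  and Id_comp [simp]: "f \<in> Ar C \<Longrightarrow> Cod C f = B \<Longrightarrow> Id C B \<cdot> f = f"
  using Comp_Id[of f A "Cod C f"] Id_Comp[of f "Dom C f" B] by simp_all

lemma Hom_Ob: "f \<in> Hom C A B \<Longrightarrow> A \<in> Ob C" "f \<in> Hom C A B \<Longrightarrow> B \<in> Ob C"
  using Dom_Ob Cod_Ob by auto

text \<open>Since \<open>assoc\<close> nests composites to the right, an equation for
  \<open>g \<cdot> f\<close> no longer matches inside a longer composite. This supplies the form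
  that does.\<close>

lemma comp_ext:
  "g \<cdot> f = h \<Longrightarrow> f \<in> Ar C \<Longrightarrow> g \<in> Ar C \<Longrightarrow> Dom C g = Cod C f \<Longrightarrow>
    x \<in> Ar C \<Longrightarrow> Cod C x = Dom C f \<Longrightarrow> g \<cdot> (f \<cdot> x) = h \<cdot> x"
  by (metis assoc)

lemma category_opp: "category (opp C)"
  by unfold_locales (auto simp: opp_def Dom_Ob Cod_Ob)

lemma monoI:
  assumes "m \<in> Hom C S A"
    and "\<And>X f g. f \<in> Hom C X S \<Longrightarrow> g \<in> Hom C X S \<Longrightarrow> m \<cdot> f = m \<cdot> g \<Longrightarrow> f = g"
  shows "is_mono C m"
  using assms by (auto simp: is_mono_def)

lemma mono_cancel:
  "is_mono C m \<Longrightarrow> f \<in> Hom C X (Dom C m) \<Longrightarrow> g \<in> Hom C X (Dom C m) \<Longrightarrow> m \<cdot> f = m \<cdot> g \<Longrightarrow> f = g"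
  unfolding is_mono_def by blast

lemma epiI:
  assumes "e \<in> Hom C A B"
    and "\<And>X f g. f \<in> Hom C B X \<Longrightarrow> g \<in> Hom C B X \<Longrightarrow> f \<cdot> e = g \<cdot> e \<Longrightarrow> f = g"
  shows "is_epi C e"
  using assms by (auto simp: is_epi_def is_mono_def opp_def)

lemma epi_cancel:
  "is_epi C e \<Longrightarrow> f \<in> Hom C (Cod C e) X \<Longrightarrow> g \<in> Hom C (Cod C e) X \<Longrightarrow> f \<cdot> e = g \<cdot> e \<Longrightarrow> f = g"
  unfolding is_epi_def is_mono_def by (auto simp: opp_def)

lemma equalizerI:
  assumes "f \<in> Hom C A B" "g \<in> Hom C A B" "e \<in> Hom C E A" "f \<cdot> e = g \<cdot> e"
    and "\<And>X h. h \<in> Hom C X A \<Longrightarrow> f \<cdot> h = g \<cdot> h \<Longrightarrow> \<exists>!u. u \<in> Hom C X E \<and> e \<cdot> u = h"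
  shows "is_equalizer C e f g"
  using assms unfolding is_equalizer_def by auto

lemma regular_mono_mono:
  assumes "regular_mono C m" shows "is_mono C m"
proof -
  obtain f g where eq: "is_equalizer C m f g" using assms by (auto simp: regular_mono_def)
  then obtain A B where *: "f \<in> Hom C A B" "g \<in> Hom C A B" "m \<in> Hom C (Dom C m) A"
    "f \<cdot> m = g \<cdot> m" unfolding is_equalizer_def by blast
  show ?thesis
  proof (rule monoI[OF *(3)])
    fix X u v assume uv: "u \<in> Hom C X (Dom C m)" "v \<in> Hom C X (Dom C m)" "m \<cdot> u = m \<cdot> v"
    have h: "m \<cdot> u \<in> Hom C X (Cod C m)" using uv * by simp
    have "f \<cdot> (m \<cdot> u) = g \<cdot> (m \<cdot> u)" using uv * comp_ext[OF *(4)] by simp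
    then have "\<exists>!w. w \<in> Hom C X (Dom C m) \<and> m \<cdot> w = m \<cdot> u"
      using eq h unfolding is_equalizer_def by blast
    then show "u = v" using uv by metis
  qed
qed

lemma coequalizer_arrows:
  assumes "is_coequalizer C e f g"
  obtains A B D where "f \<in> Hom C A B" "g \<in> Hom C A B" "e \<in> Hom C B D" "e \<cdot> f = e \<cdot> g"
  using assms by (auto simp: is_coequalizer_def is_equalizer_def opp_def)

lemma coequalizer_Hom:
  assumes "is_coequalizer C e f g"
  shows "f \<in> Hom C (Dom C f) (Dom C e)" "g \<in> Hom C (Dom C f) (Dom C e)" "e \<cdot> f = e \<cdot> g" "e \<in> Ar C"
  using assms by (rule coequalizer_arrows; simp)+

lemma coequalizer_factor:
  assumes "is_coequalizer C e f g" "h \<in> Hom C (Dom C e) X" "h \<cdot> f = h \<cdot> g"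
  obtains u where "u \<in> Hom C (Cod C e) X" "u \<cdot> e = h"
proof -
  have "\<exists>!u. u \<in> Hom (opp C) X (Dom (opp C) e) \<and> e \<cdot>\<^bsub>opp C\<^esub> u = h"
    using assms unfolding is_coequalizer_def is_equalizer_def by (simp add: Hom_opp del: Hom_def)
  then show thesis using that by (auto simp: Hom_opp simp del: Hom_def)
qed

lemma coequalizerI:
  assumes "f \<in> Hom C A B" "g \<in> Hom C A B" "e \<in> Hom C B D" "e \<cdot> f = e \<cdot> g"
    and "\<And>X h. h \<in> Hom C B X \<Longrightarrow> h \<cdot> f = h \<cdot> g \<Longrightarrow> \<exists>!u. u \<in> Hom C D X \<and> u \<cdot> e = h"
  shows "is_coequalizer C e f g"
proof -
  interpret op: category "opp C" by (rule category_opp)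
  show ?thesis unfolding is_coequalizer_def
    by (rule op.equalizerI[of f B A g e D]) (use assms in \<open>simp_all add: Hom_opp del: Hom_def\<close>)
qed

lemma coequalizer_epi:
  assumes "is_coequalizer C e f g" shows "is_epi C e"
  using assms category.regular_mono_mono[OF category_opp]
  unfolding is_coequalizer_def is_epi_def regular_mono_def by blast

text \<open>With section \<open>s\<close>, the arrow \<open>p\<close> is the coequalizer of the
  idempotent \<open>s \<cdot> p\<close> and the identity; a factorization of \<open>h\<close>
  through \<open>p\<close> can only be \<open>h \<cdot> s\<close>.\<close>

lemma split_epi_regular:
  assumes "p \<in> Hom C A B" "s \<in> Hom C B A" "p \<cdot> s = Id C B"
  shows "regular_epi C p"
proof -
  have [simp]: "A \<in> Ob C" "B \<in> Ob C" using assms Hom_Ob by blast+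
  have "is_coequalizer C p (s \<cdot> p) (Id C A)"
  proof (rule coequalizerI)
    show "p \<cdot> (s \<cdot> p) = p \<cdot> Id C A" using assms comp_ext[OF assms(3)] by simp
    fix X h assume h: "h \<in> Hom C A X" "h \<cdot> (s \<cdot> p) = h \<cdot> Id C A"
    show "\<exists>!u. u \<in> Hom C B X \<and> u \<cdot> p = h"
    proof (intro ex1I[of _ "h \<cdot> s"] conjI)
      fix u assume u: "u \<in> Hom C B X \<and> u \<cdot> p = h"
      then have "u \<cdot> (p \<cdot> s) = h \<cdot> s" using assms(1,2) by (auto simp flip: assoc)
      then show "u = h \<cdot> s" using u assms by simp
    qed (use h assms in simp_all)
  qed (use assms in simp_all)
  then show ?thesis by (auto simp: regular_epi_def)
qed

lemma pullback_arrows: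
  assumes "is_pullback C t l r b"
  obtains P A B D where "t \<in> Hom C P A" "l \<in> Hom C P B" "r \<in> Hom C A D" "b \<in> Hom C B D"
    "r \<cdot> t = b \<cdot> l"
  using assms by (auto simp: is_pullback_def comm_square_def)

lemma pullback_Hom:
  assumes "is_pullback C t l r b"
  shows "t \<in> Hom C (Dom C t) (Dom C r)" "l \<in> Hom C (Dom C t) (Dom C b)" "r \<cdot> t = b \<cdot> l"
    "r \<in> Ar C" "b \<in> Ar C" "Cod C r = Cod C b"
  using assms by (rule pullback_arrows; simp)+

lemma pullback_factor:
  assumes "is_pullback C t l r b" "x \<in> Hom C X (Dom C r)" "y \<in> Hom C X (Dom C b)" "r \<cdot> x = b \<cdot> y"
  obtains u where "u \<in> Hom C X (Dom C t)" "t \<cdot> u = x" "l \<cdot> u = y"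
proof -
  have "comm_square C x y r b"
    using assms(2-) pullback_arrows[OF assms(1)] by (auto simp: comm_square_def)
  then have "\<exists>!u. u \<in> Hom C (Dom C x) (Dom C t) \<and> t \<cdot> u = x \<and> l \<cdot> u = y"
    using assms(1) unfolding is_pullback_def by blast
  then show ?thesis using assms(2) that by auto
qed

lemma pullbackI:
  assumes "t \<in> Hom C P A" "l \<in> Hom C P B" "r \<in> Hom C A D" "b \<in> Hom C B D" "r \<cdot> t = b \<cdot> l"
    and "\<And>X x y. x \<in> Hom C X A \<Longrightarrow> y \<in> Hom C X B \<Longrightarrow> r \<cdot> x = b \<cdot> y \<Longrightarrow>
      \<exists>!u. u \<in> Hom C X P \<and> t \<cdot> u = x \<and> l \<cdot> u = y"
  shows "is_pullback C t l r b"
  unfolding is_pullback_def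
proof (intro conjI allI impI)
  show "comm_square C t l r b" using assms(1-5) unfolding comm_square_def by blast
  fix x y assume "comm_square C x y r b"
  then show "\<exists>!u. u \<in> Hom C (Dom C x) (Dom C t) \<and> t \<cdot> u = x \<and> l \<cdot> u = y"
    using assms(1,3,4) assms(6)[of x "Dom C x" y] by (auto simp: comm_square_def)
qed

text \<open>Degenerate squares that serve as summands in Condition P (b): adding them yields
  pullbacks of arrows such as \<open>Id C A \<oplus> k\<close> along arrows such as
  \<open>m \<oplus> Id C S\<close>.\<close>

lemma pullback_Id_left:
  assumes "f \<in> Hom C X Y" shows "is_pullback C f (Id C X) (Id C Y) f"
proof (rule pullbackI)
  fix Z x y assume *: "x \<in> Hom C Z Y" "y \<in> Hom C Z X" "Id C Y \<cdot> x = f \<cdot> y"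
  then show "\<exists>!u. u \<in> Hom C Z X \<and> f \<cdot> u = x \<and> Id C X \<cdot> u = y"
    using assms by (intro ex1I[of _ y]) auto
qed (use assms Hom_Ob[OF assms] in auto)

lemma pullback_Id_right:
  assumes "f \<in> Hom C X Y" shows "is_pullback C (Id C X) f f (Id C Y)"
proof (rule pullbackI)
  fix Z x y assume *: "x \<in> Hom C Z X" "y \<in> Hom C Z Y" "f \<cdot> x = Id C Y \<cdot> y"
  then show "\<exists>!u. u \<in> Hom C Z X \<and> Id C X \<cdot> u = x \<and> f \<cdot> u = y"
    using assms by (intro ex1I[of _ x]) (simp, elim conjE, simp)
qed (use assms Hom_Ob[OF assms] in auto)

text \<open>Together with \<open>pullback_mono\<close> this expresses monicity by a pullback square,
  the form in which Condition P (b) carries it to coproducts.\<close>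

lemma mono_pullback:
  assumes "is_mono C m" "m \<in> Hom C S A"
  shows "is_pullback C (Id C S) (Id C S) m m"
proof (rule pullbackI)
  have [simp]: "S \<in> Ob C" using assms Hom_Ob by blast
  fix X x y assume *: "x \<in> Hom C X S" "y \<in> Hom C X S" "m \<cdot> x = m \<cdot> y"
  then have "x = y" using assms mono_cancel[OF assms(1), of x X y] by simp
  then show "\<exists>!u. u \<in> Hom C X S \<and> Id C S \<cdot> u = x \<and> Id C S \<cdot> u = y"
    using * by (intro ex1I[of _ x]) auto
qed (use assms Hom_Ob in auto)

text \<open>Arrows identified by \<open>m\<close> are \<open>i \<cdot> u\<close> for one and the
  same \<open>u\<close>. An arbitrary \<open>i\<close> is allowed so that
  \<open>Id C S \<oplus> Id C T\<close> fits directly.\<close>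

lemma pullback_mono:
  assumes "is_pullback C i i m m" "i \<in> Hom C S S"
  shows "is_mono C m"
proof (rule monoI)
  show m: "m \<in> Hom C S (Cod C m)" using assms by (elim pullback_arrows) simp
  fix X f g assume "f \<in> Hom C X S" "g \<in> Hom C X S" "m \<cdot> f = m \<cdot> g"
  then obtain u where "i \<cdot> u = f" "i \<cdot> u = g"
    using pullback_factor[OF assms(1), of f X g] m by auto
  then show "f = g" by simp
qed

lemma is_iso_of_regular_mono_epi:
  assumes "regular_mono C m" "is_epi C m" shows "is_iso C m"
proof -
  obtain f g where eq: "is_equalizer C m f g" using assms by (auto simp: regular_mono_def)
  then obtain A B where *: "f \<in> Hom C A B" "g \<in> Hom C A B" "m \<in> Hom C (Dom C m) A"
    "f \<cdot> m = g \<cdot> m" unfolding is_equalizer_def by blast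
  have [simp]: "A \<in> Ob C" "Dom C m \<in> Ob C" using * Hom_Ob by blast+
  \<comment> \<open>The epimorphism \<open>m\<close> equalizes only equal arrows, so the identity of
    \<open>A\<close> equalizes \<open>f\<close> and \<open>g\<close> and factors through
    \<open>m\<close>.\<close>
  have "f = g" using epi_cancel[OF assms(2)] * by auto
  moreover have "Id C A \<in> Hom C A (Cod C m)" using * by simp
  ultimately have "\<exists>!u. u \<in> Hom C A (Dom C m) \<and> m \<cdot> u = Id C A"
    using eq unfolding is_equalizer_def by blast
  then obtain u where u: "u \<in> Hom C A (Dom C m)" "m \<cdot> u = Id C A" by blast
  have "u \<cdot> m = Id C (Dom C m)"
    by (rule mono_cancel[OF regular_mono_mono[OF assms(1)], of _ "Dom C m"])
      (use u * comp_ext[OF u(2)] in simp_all)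
  then show ?thesis using u * by (auto simp: is_iso_def)
qed

end

section \<open>Finite limits\<close>

context category
begin

text \<open>A bipartite graph generates a category without further arrows, so products, equalizers
  and pullbacks are all limits over such shapes.\<close>

lemma bipartite_limit:
  fixes V E :: "nat set"
  assumes fc: "finitely_complete C"
    and fin: "finite V" "finite E" "V \<inter> E = {}"
    and st: "\<And>e. e \<in> E \<Longrightarrow> src e \<in> V" "\<And>e. e \<in> E \<Longrightarrow> tgt e \<in> V"
    and bip: "\<And>e e'. e \<in> E \<Longrightarrow> e' \<in> E \<Longrightarrow> tgt e \<noteq> src e'"
    and F: "\<And>v. v \<in> V \<Longrightarrow> F v \<in> Ob C" "\<And>e. e \<in> E \<Longrightarrow> d e \<in> Hom C (F (src e)) (F (tgt e))"
  obtains L c where "L \<in> Ob C" "\<And>v. v \<in> V \<Longrightarrow> c v \<in> Hom C L (F v)"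
    "\<And>e. e \<in> E \<Longrightarrow> d e \<cdot> c (src e) = c (tgt e)"
    "\<And>X x. X \<in> Ob C \<Longrightarrow> (\<And>v. v \<in> V \<Longrightarrow> x v \<in> Hom C X (F v)) \<Longrightarrow>
       (\<And>e. e \<in> E \<Longrightarrow> d e \<cdot> x (src e) = x (tgt e)) \<Longrightarrow>
       \<exists>!u. u \<in> Hom C X L \<and> (\<forall>v\<in>V. c v \<cdot> u = x v)"
proof -
  \<comment> \<open>A vertex is its own identity arrow. As no edge ends where an edge starts, one of
    two composable arrows is always an identity, which makes the case distinction in
    \<open>Comp\<close> correct.\<close>
  define J :: "(nat, nat) cat" where
    "J = \<lparr>Ob = V, Ar = V \<union> E, Dom = (\<lambda>a. if a \<in> V then a else src a),
          Cod = (\<lambda>a. if a \<in> V then a else tgt a), Id = (\<lambda>v. v),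
          Comp = (\<lambda>g f. if f \<in> V then g else f)\<rparr>"
  define Fa where "Fa a = (if a \<in> V then Id C (F a) else d a)" for a
  have J: "category J"
    by unfold_locales (use st bip[THEN not_sym] in \<open>auto simp: J_def split: if_splits\<close>)
  have "is_functor J C F Fa"
    unfolding is_functor_def
  proof (intro conjI ballI impI)
    fix u v assume "u \<in> Ar J" "v \<in> Ar J" "Cod J u = Dom J v"
    then show "Fa (Comp J v u) = Fa v \<cdot> Fa u"
      using F st bip by (auto simp: J_def Fa_def split: if_splits)
  qed (use F st in \<open>auto simp: J_def Fa_def\<close>)
  moreover have "finite (Ob J)" "finite (Ar J)" using fin by (simp_all add: J_def)
  ultimately obtain L c where lim: "is_limit J C F Fa L c"
    using fc J unfolding finitely_complete_def by blast
  have cone: "is_cone J C F Fa X x \<longleftrightarrow> X \<in> Ob C \<and> (\<forall>v\<in>V. x v \<in> Hom C X (F v)) \<and>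
      (\<forall>e\<in>E. d e \<cdot> x (src e) = x (tgt e))" for X x
    using fin(3) F(1) by (auto simp: is_cone_def J_def Fa_def)
  show thesis
  proof (rule that[of L c])
    fix X x assume "X \<in> Ob C" "\<And>v. v \<in> V \<Longrightarrow> x v \<in> Hom C X (F v)"
       "\<And>e. e \<in> E \<Longrightarrow> d e \<cdot> x (src e) = x (tgt e)"
    then have "is_cone J C F Fa X x" by (simp add: cone)
    then show "\<exists>!u. u \<in> Hom C X L \<and> (\<forall>v\<in>V. c v \<cdot> u = x v)"
      using lim unfolding is_limit_def by (simp add: J_def)
  qed (use lim in \<open>auto simp: is_limit_def cone\<close>)
qed

lemma products_of_finitely_complete:
  assumes "finitely_complete C" "A \<in> Ob C" "B \<in> Ob C"
  obtains P p q where "p \<in> Hom C P A" "q \<in> Hom C P B"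
    "\<And>X f g. f \<in> Hom C X A \<Longrightarrow> g \<in> Hom C X B \<Longrightarrow>
      \<exists>!u. u \<in> Hom C X P \<and> p \<cdot> u = f \<and> q \<cdot> u = g"
proof -
  define F where "F v = (if v = 0 then A else B)" for v :: nat
  obtain L c where L: "L \<in> Ob C" "\<And>v. v \<in> {0, 1::nat} \<Longrightarrow> c v \<in> Hom C L (F v)"
    "\<And>X x. X \<in> Ob C \<Longrightarrow> (\<And>v. v \<in> {0, 1::nat} \<Longrightarrow> x v \<in> Hom C X (F v)) \<Longrightarrow>
       \<exists>!u. u \<in> Hom C X L \<and> (\<forall>v\<in>{0, 1}. c v \<cdot> u = x v)"
    by (rule bipartite_limit[OF assms(1), of "{0, 1}" "{}" "\<lambda>_. 0" "\<lambda>_. 0" F])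
      (use assms in \<open>auto simp: F_def\<close>)
  show thesis
  proof (rule that[of "c 0" L "c 1"])
    fix X f g assume fg: "f \<in> Hom C X A" "g \<in> Hom C X B"
    show "\<exists>!u. u \<in> Hom C X L \<and> c 0 \<cdot> u = f \<and> c 1 \<cdot> u = g"
    proof -
      have "\<exists>!u. u \<in> Hom C X L \<and> (\<forall>v\<in>{0, 1}. c v \<cdot> u = (if v = 0 then f else g))"
        by (rule L(3)) (use fg Dom_Ob in \<open>auto simp: F_def\<close>)
      then show ?thesis by simp
    qed
  qed (use L(2)[of 0] L(2)[of 1] in \<open>auto simp: F_def\<close>)
qed

lemma equalizers_of_finitely_complete:
  assumes "finitely_complete C" "f \<in> Hom C A B" "g \<in> Hom C A B"
  obtains e where "is_equalizer C e f g"
proof -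
  \<comment> \<open>The shape has two parallel edges, 2 carrying \<open>f\<close> and 3 carrying
    \<open>g\<close>, from vertex 0 to vertex 1.\<close>
  define F where "F v = (if v = 0 then A else B)" for v :: nat
  define d where "d e = (if e = 2 then f else g)" for e :: nat
  obtain L c where L: "L \<in> Ob C" "\<And>v. v \<in> {0, 1::nat} \<Longrightarrow> c v \<in> Hom C L (F v)"
    "\<And>e. e \<in> {2, 3::nat} \<Longrightarrow> d e \<cdot> c 0 = c 1"
    "\<And>X x. X \<in> Ob C \<Longrightarrow> (\<And>v. v \<in> {0, 1::nat} \<Longrightarrow> x v \<in> Hom C X (F v)) \<Longrightarrow>
       (\<And>e. e \<in> {2, 3::nat} \<Longrightarrow> d e \<cdot> x 0 = x 1) \<Longrightarrow>
       \<exists>!u. u \<in> Hom C X L \<and> (\<forall>v\<in>{0, 1}. c v \<cdot> u = x v)"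
    by (rule bipartite_limit[OF assms(1), of "{0, 1}" "{2, 3}" "\<lambda>_. 0" "\<lambda>_. 1" F d])
      (use assms Dom_Ob Cod_Ob in \<open>auto simp: F_def d_def\<close>)
  have c: "c 0 \<in> Hom C L A" "f \<cdot> c 0 = c 1" "g \<cdot> c 0 = c 1"
    using L(2)[of 0] L(3)[of 2] L(3)[of 3] by (auto simp: F_def d_def)
  have "is_equalizer C (c 0) f g"
  proof (rule equalizerI[OF assms(2,3) c(1)])
    fix X h assume h: "h \<in> Hom C X A" "f \<cdot> h = g \<cdot> h"
    have "\<exists>!u. u \<in> Hom C X L \<and> (\<forall>v\<in>{0, 1}. c v \<cdot> u = (if v = 0 then h else f \<cdot> h))"
      by (rule L(4)) (use h assms Dom_Ob in \<open>auto simp: F_def d_def\<close>)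
    moreover have comp: "c 1 \<cdot> u = f \<cdot> h" if "u \<in> Hom C X L" "c 0 \<cdot> u = h" for u
      using comp_ext[OF c(2), of u] that c(1) assms(2) by simp
    ultimately have "\<exists>!u. u \<in> Hom C X L \<and> c 0 \<cdot> u = h \<and> c 1 \<cdot> u = f \<cdot> h" by simp
    with comp show "\<exists>!u. u \<in> Hom C X L \<and> c 0 \<cdot> u = h" by metis
  qed (use c in simp)
  then show thesis by (rule that)
qed

lemma pullbacks_of_finitely_complete:
  assumes "finitely_complete C" "r \<in> Hom C A D" "b \<in> Hom C B D"
  obtains t l where "is_pullback C t l r b"
proof -
  \<comment> \<open>Edge \<open>e\<close> runs from vertex \<open>e - 3\<close> to vertex 2, so that
    edge 3 carries \<open>r\<close> and edge 4 carries \<open>b\<close>.\<close>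
  define F where "F v = (if v = 0 then A else if v = 1 then B else D)" for v :: nat
  define d where "d e = (if e = 3 then r else b)" for e :: nat
  obtain L c where L: "L \<in> Ob C" "\<And>v. v \<in> {0, 1, 2::nat} \<Longrightarrow> c v \<in> Hom C L (F v)"
    "\<And>e. e \<in> {3, 4::nat} \<Longrightarrow> d e \<cdot> c (e - 3) = c 2"
    "\<And>X x. X \<in> Ob C \<Longrightarrow> (\<And>v. v \<in> {0, 1, 2::nat} \<Longrightarrow> x v \<in> Hom C X (F v)) \<Longrightarrow>
       (\<And>e. e \<in> {3, 4::nat} \<Longrightarrow> d e \<cdot> x (e - 3) = x 2) \<Longrightarrow>
       \<exists>!u. u \<in> Hom C X L \<and> (\<forall>v\<in>{0, 1, 2}. c v \<cdot> u = x v)"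
    by (rule bipartite_limit[OF assms(1), of "{0, 1, 2}" "{3, 4}" "\<lambda>e. e - 3" "\<lambda>_. 2" F d])
      (use assms Dom_Ob Cod_Ob in \<open>auto simp: F_def d_def\<close>)
  have c: "c 0 \<in> Hom C L A" "c 1 \<in> Hom C L B" "r \<cdot> c 0 = c 2" "b \<cdot> c 1 = c 2"
    using L(2)[of 0] L(2)[of 1] L(3)[of 3] L(3)[of 4] by (auto simp: F_def d_def)
  have "is_pullback C (c 0) (c 1) r b"
  proof (rule pullbackI[OF c(1,2) assms(2,3)])
    fix X x y assume xy: "x \<in> Hom C X A" "y \<in> Hom C X B" "r \<cdot> x = b \<cdot> y"
    have "\<exists>!u. u \<in> Hom C X L \<and>
        (\<forall>v\<in>{0, 1, 2}. c v \<cdot> u = (if v = 0 then x else if v = 1 then y else r \<cdot> x))"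
      by (rule L(4)) (use xy assms Dom_Ob in \<open>auto simp: F_def d_def\<close>)
    moreover have comp: "c 2 \<cdot> u = r \<cdot> x" if "u \<in> Hom C X L" "c 0 \<cdot> u = x" for u
      using comp_ext[OF c(3), of u] that c(1) assms(2) by simp
    ultimately have "\<exists>!u. u \<in> Hom C X L \<and> c 0 \<cdot> u = x \<and> c 1 \<cdot> u = y \<and> c 2 \<cdot> u = r \<cdot> x"
      by simp
    with comp show "\<exists>!u. u \<in> Hom C X L \<and> c 0 \<cdot> u = x \<and> c 1 \<cdot> u = y" by metis
  qed (use c in simp)
  then show thesis by (rule that)
qed

text \<open>The limit is the equalizer of two arrows from the product over the objects of the shape
  to the product over its arrows. It is applied in the opposite category, to build finite
  colimits.\<close>

lemma finitely_completeI:
  assumes prod: "has_finite_products C"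
    and eq: "\<And>f g A B. f \<in> Hom C A B \<Longrightarrow> g \<in> Hom C A B \<Longrightarrow> \<exists>e. is_equalizer C e f g"
  shows "finitely_complete C"
  unfolding finitely_complete_def
proof (intro allI impI)
  fix J :: "(nat, nat) cat" and Fo Fa
  assume *: "category J \<and> finite (Ob J) \<and> finite (Ar J) \<and> is_functor J C Fo Fa"
  then interpret J: category J by simp
  have F: "\<And>i. i \<in> Ob J \<Longrightarrow> Fo i \<in> Ob C"
    "\<And>u. u \<in> Ar J \<Longrightarrow> Fa u \<in> Hom C (Fo (Dom J u)) (Fo (Cod J u))"
    using * unfolding is_functor_def by blast+
  have "\<exists>P\<in>Ob C. \<exists>p. (\<forall>i\<in>Ob J. p i \<in> Hom C P (Fo i)) \<and>
      (\<forall>Y\<in>Ob C. \<forall>f. (\<forall>i\<in>Ob J. f i \<in> Hom C Y (Fo i)) \<longrightarrow>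
        (\<exists>!u. u \<in> Hom C Y P \<and> (\<forall>i\<in>Ob J. p i \<cdot> u = f i)))"
    by (rule prod[unfolded has_finite_products_def, rule_format]) (use F(1) * in blast)
  then obtain P p where P0: "P \<in> Ob C" "\<forall>i\<in>Ob J. p i \<in> Hom C P (Fo i)"
    "\<forall>Y\<in>Ob C. \<forall>f. (\<forall>i\<in>Ob J. f i \<in> Hom C Y (Fo i)) \<longrightarrow>
        (\<exists>!u. u \<in> Hom C Y P \<and> (\<forall>i\<in>Ob J. p i \<cdot> u = f i))"
    by (elim bexE exE conjE)
  note P = P0(1) P0(2)[rule_format] P0(3)[rule_format]
  have "\<exists>Q\<in>Ob C. \<exists>q. (\<forall>u\<in>Ar J. q u \<in> Hom C Q (Fo (Cod J u))) \<and>
      (\<forall>Y\<in>Ob C. \<forall>f. (\<forall>u\<in>Ar J. f u \<in> Hom C Y (Fo (Cod J u))) \<longrightarrow>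
        (\<exists>!h. h \<in> Hom C Y Q \<and> (\<forall>u\<in>Ar J. q u \<cdot> h = f u)))"
    by (rule prod[unfolded has_finite_products_def, rule_format, of "Ar J" "\<lambda>u. Fo (Cod J u)"])
      (use F(1) J.Cod_Ob * in blast)
  then obtain Q q where Q0: "Q \<in> Ob C" "\<forall>u\<in>Ar J. q u \<in> Hom C Q (Fo (Cod J u))"
    "\<forall>Y\<in>Ob C. \<forall>f. (\<forall>u\<in>Ar J. f u \<in> Hom C Y (Fo (Cod J u))) \<longrightarrow>
        (\<exists>!h. h \<in> Hom C Y Q \<and> (\<forall>u\<in>Ar J. q u \<cdot> h = f u))"
    by (elim bexE exE conjE)
  note Q = Q0(1) Q0(2)[rule_format] Q0(3)[rule_format]
  \<comment> \<open>At an arrow \<open>u\<close> of the shape, \<open>s\<close> reads off the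
    component at the codomain, while \<open>t\<close> applies \<open>Fa u\<close> to the component
    at the domain. Thus \<open>h\<close> equalizes them exactly when its components form a
    cone.\<close>
  obtain s where s: "s \<in> Hom C P Q" "\<And>u. u \<in> Ar J \<Longrightarrow> q u \<cdot> s = p (Cod J u)"
    using Q(3)[of P "\<lambda>u. p (Cod J u)"] P(1,2) J.Cod_Ob by blast
  have "Fa u \<cdot> p (Dom J u) \<in> Hom C P (Fo (Cod J u))" if "u \<in> Ar J" for u
    using F(2)[OF that] P(2) J.Dom_Ob[OF that] by simp
  then obtain t where t: "t \<in> Hom C P Q" "\<And>u. u \<in> Ar J \<Longrightarrow> q u \<cdot> t = Fa u \<cdot> p (Dom J u)"
    using Q(3)[of P "\<lambda>u. Fa u \<cdot> p (Dom J u)"] P(1) by blast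
  obtain e where e: "is_equalizer C e s t" using eq[OF s(1) t(1)] by blast
  then have ee: "e \<in> Hom C (Dom C e) P" "s \<cdot> e = t \<cdot> e"
    using s(1) unfolding is_equalizer_def by auto
  have cone_iff: "s \<cdot> h = t \<cdot> h \<longleftrightarrow> (\<forall>u\<in>Ar J. Fa u \<cdot> (p (Dom J u) \<cdot> h) = p (Cod J u) \<cdot> h)"
    if h: "h \<in> Hom C X P" for h X
  proof -
    have 1: "q u \<cdot> (s \<cdot> h) = p (Cod J u) \<cdot> h" if "u \<in> Ar J" for u
      using that s(1) Q(2) h comp_ext[OF s(2)] by simp
    have 2: "q u \<cdot> (t \<cdot> h) = Fa u \<cdot> (p (Dom J u) \<cdot> h)" if "u \<in> Ar J" for u
      using that t(1) Q(2) h comp_ext[OF t(2)] P(2) F(2) J.Dom_Ob by simp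
    have "\<exists>!k. k \<in> Hom C X Q \<and> (\<forall>u\<in>Ar J. q u \<cdot> k = p (Cod J u) \<cdot> h)"
      by (rule Q(3)) (use h Hom_Ob[OF h] P(2) J.Cod_Ob in simp_all)
    moreover have "s \<cdot> h \<in> Hom C X Q" "t \<cdot> h \<in> Hom C X Q" using h s t by simp_all
    ultimately show ?thesis using 1 2 by metis
  qed
  have "is_limit J C Fo Fa (Dom C e) (\<lambda>i. p i \<cdot> e)"
    unfolding is_limit_def
  proof (intro conjI allI impI)
    show "is_cone J C Fo Fa (Dom C e) (\<lambda>i. p i \<cdot> e)"
      unfolding is_cone_def using ee P(2) Hom_Ob[OF ee(1)] cone_iff[OF ee(1)] by simp
    fix X d assume d: "is_cone J C Fo Fa X d"
    then obtain h where h: "h \<in> Hom C X P" "\<And>i. i \<in> Ob J \<Longrightarrow> p i \<cdot> h = d i"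
      using P(3)[of X d] unfolding is_cone_def by blast
    have "s \<cdot> h = t \<cdot> h"
      unfolding cone_iff[OF h(1)] using d h(2) J.Dom_Ob J.Cod_Ob by (simp add: is_cone_def)
    moreover have "h \<in> Hom C X (Cod C e)" using h(1) ee by simp
    ultimately have u: "\<exists>!u. u \<in> Hom C X (Dom C e) \<and> e \<cdot> u = h"
      using e unfolding is_equalizer_def by blast
    have "(\<forall>i\<in>Ob J. (p i \<cdot> e) \<cdot> u = d i) \<longleftrightarrow> e \<cdot> u = h" if u: "u \<in> Hom C X (Dom C e)" for u
    proof -
      have "\<exists>!k. k \<in> Hom C X P \<and> (\<forall>i\<in>Ob J. p i \<cdot> k = d i)"
        using P(3)[of X d] d unfolding is_cone_def by blast
      moreover have "e \<cdot> u \<in> Hom C X P" using u ee by simp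
      ultimately have "(\<forall>i\<in>Ob J. p i \<cdot> (e \<cdot> u) = d i) \<longleftrightarrow> e \<cdot> u = h" using h by metis
      then show ?thesis using u ee P(2) by simp
    qed
    then show "\<exists>!u. u \<in> Hom C X (Dom C e) \<and> (\<forall>i\<in>Ob J. (p i \<cdot> e) \<cdot> u = d i)"
      using u by metis
  qed
  then show "\<exists>L c. is_limit J C Fo Fa L c" by blast
qed

end

section \<open>Binary coproducts\<close>

notation copair ("\<langle>_, _\<rangle>\<index>")
notation coprod_map (infixl "\<oplus>\<index>" 75)
notation coprod (infixl "\<amalg>\<index>" 75)

locale category_with_coproducts = category +
  assumes coproducts: "has_finite_coproducts C"
begin

text \<open>A coproduct over the index set \<open>{0, 1}\<close> is a binary coproduct, so the
  choice made in \<open>coproj\<close> has a candidate.\<close>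

lemma is_coproduct_coproj:
  assumes "A \<in> Ob C" "B \<in> Ob C"
  shows "is_coproduct C A B (inl C A B) (inr C A B)"
proof -
  define X where "X i = (if i = 0 then A else B)" for i :: nat
  have "\<exists>P\<in>Ob C. \<exists>p. (\<forall>i\<in>{0, 1}. p i \<in> Hom (opp C) P (X i)) \<and>
      (\<forall>Y\<in>Ob C. \<forall>f. (\<forall>i\<in>{0, 1}. f i \<in> Hom (opp C) Y (X i)) \<longrightarrow>
        (\<exists>!u. u \<in> Hom (opp C) Y P \<and> (\<forall>i\<in>{0, 1}. u \<cdot> p i = f i)))"
    using coproducts[unfolded has_finite_coproducts_def has_finite_products_def,
        rule_format, of "{0, 1}" X] assms by (simp add: X_def)
  then obtain P p where P: "P \<in> Ob C" "\<forall>i\<in>{0, 1}. p i \<in> Hom (opp C) P (X i)"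
      "\<forall>Y\<in>Ob C. \<forall>f. (\<forall>i\<in>{0, 1}. f i \<in> Hom (opp C) Y (X i)) \<longrightarrow>
        (\<exists>!u. u \<in> Hom (opp C) Y P \<and> (\<forall>i\<in>{0, 1}. u \<cdot> p i = f i))"
    by (elim bexE exE conjE)
  have p: "p 0 \<in> Hom C A P" "p 1 \<in> Hom C B P" using P(2) by (auto simp: X_def)
  have "is_product (opp C) A B (p 0) (p 1)"
    unfolding is_product_def
  proof (intro conjI allI ballI)
    show "\<exists>P. p 0 \<in> Hom (opp C) P A \<and> p 1 \<in> Hom (opp C) P B" using p by auto
    fix Y f g assume fg: "f \<in> Hom (opp C) Y A" "g \<in> Hom (opp C) Y B"
    have "\<exists>!u. u \<in> Hom (opp C) Y P \<and> (\<forall>i\<in>{0, 1}. u \<cdot> p i = (if i = 0 then f else g))"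
      by (rule P(3)[rule_format]) (use fg Cod_Ob in \<open>auto simp: X_def\<close>)
    then show "\<exists>!u. u \<in> Hom (opp C) Y (Dom (opp C) (p 0)) \<and>
        p 0 \<cdot>\<^bsub>opp C\<^esub> u = f \<and> p 1 \<cdot>\<^bsub>opp C\<^esub> u = g"
      using p by (simp del: Hom_def) simp
  qed
  then have "is_coproduct C A B (fst (p 0, p 1)) (snd (p 0, p 1))"
    by (simp add: is_coproduct_def)
  then show ?thesis unfolding inl_def inr_def coproj_def by (rule someI)
qed

lemma
  assumes "A \<in> Ob C" "B \<in> Ob C"
  shows inl_Ar [simp]: "inl C A B \<in> Ar C" and dom_inl [simp]: "Dom C (inl C A B) = A"
    and cod_inl [simp]: "Cod C (inl C A B) = A \<amalg> B"
    and inr_Ar [simp]: "inr C A B \<in> Ar C" and dom_inr [simp]: "Dom C (inr C A B) = B"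
    and cod_inr [simp]: "Cod C (inr C A B) = A \<amalg> B"
  using is_coproduct_coproj[OF assms]
  by (auto simp: is_coproduct_def is_product_def coprod_def)

lemma coprod_Ob [simp]: "A \<in> Ob C \<Longrightarrow> B \<in> Ob C \<Longrightarrow> A \<amalg> B \<in> Ob C"
  using Cod_Ob[of "inl C A B"] by simp

lemma coproduct_universal:
  assumes "f \<in> Hom C A X" "g \<in> Hom C B X"
  shows "\<exists>!h. h \<in> Hom C (A \<amalg> B) X \<and> h \<cdot> inl C A B = f \<and> h \<cdot> inr C A B = g"
proof -
  have AB: "A \<in> Ob C" "B \<in> Ob C" using assms Hom_Ob by blast+
  have "\<exists>!h. h \<in> Hom (opp C) X (Dom (opp C) (inl C A B)) \<and>
      inl C A B \<cdot>\<^bsub>opp C\<^esub> h = f \<and> inr C A B \<cdot>\<^bsub>opp C\<^esub> h = g"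
    using is_coproduct_coproj[OF AB] assms unfolding is_coproduct_def is_product_def Hom_opp
    by blast
  then show ?thesis using AB by (simp add: Hom_opp del: Hom_def)
qed

lemma coprod_eqI:
  assumes "h \<in> Hom C (A \<amalg> B) X" "k \<in> Hom C (A \<amalg> B) X" "A \<in> Ob C" "B \<in> Ob C"
    and "h \<cdot> inl C A B = k \<cdot> inl C A B" "h \<cdot> inr C A B = k \<cdot> inr C A B"
  shows "h = k"
proof -
  have "h \<cdot> inl C A B \<in> Hom C A X" "h \<cdot> inr C A B \<in> Hom C B X" using assms by simp_all
  from coproduct_universal[OF this] show ?thesis using assms(1,2,5,6) by metis
qed

lemma copair_props:
  assumes "f \<in> Hom C A X" "g \<in> Hom C B X"
  shows "\<langle>f, g\<rangle> \<in> Hom C (A \<amalg> B) X \<and> \<langle>f, g\<rangle> \<cdot> inl C A B = f \<and> \<langle>f, g\<rangle> \<cdot> inr C A B = g"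
proof -
  have "Dom C f = A" "Dom C g = B" "Cod C f = X" using assms by simp_all
  then show ?thesis
    using theI'[OF coproduct_universal[OF assms]] unfolding copair_def by simp
qed

lemma
  assumes "f \<in> Ar C" "g \<in> Ar C" "Cod C f = Cod C g"
  shows copair_Ar [simp]: "\<langle>f, g\<rangle> \<in> Ar C"
    and dom_copair [simp]: "Dom C \<langle>f, g\<rangle> = Dom C f \<amalg> Dom C g"
    and cod_copair [simp]: "Cod C \<langle>f, g\<rangle> = Cod C g"
  using copair_props[of f "Dom C f" "Cod C g" g "Dom C g"] assms by simp_all

lemma
  assumes "f \<in> Ar C" "g \<in> Ar C" "Cod C f = Cod C g" "Dom C f = A" "Dom C g = B"
  shows copair_inl [simp]: "\<langle>f, g\<rangle> \<cdot> inl C A B = f"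
    and copair_inr [simp]: "\<langle>f, g\<rangle> \<cdot> inr C A B = g"
  using copair_props[of f "Dom C f" "Cod C g" g "Dom C g"] assms by simp_all

lemma
  assumes "f \<in> Ar C" "g \<in> Ar C" "Cod C f = Cod C g" "Dom C f = A" "Dom C g = B"
  shows copair_inl_comp [simp]:
      "x \<in> Ar C \<Longrightarrow> Cod C x = A \<Longrightarrow> \<langle>f, g\<rangle> \<cdot> (inl C A B \<cdot> x) = f \<cdot> x"
    and copair_inr_comp [simp]:
      "x \<in> Ar C \<Longrightarrow> Cod C x = B \<Longrightarrow> \<langle>f, g\<rangle> \<cdot> (inr C A B \<cdot> x) = g \<cdot> x"
  using comp_ext[OF copair_inl[OF assms], of x] comp_ext[OF copair_inr[OF assms], of x] assms
    Dom_Ob[of f] Dom_Ob[of g] by simp_all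

lemma comp_copair [simp]:
  assumes "f \<in> Ar C" "g \<in> Ar C" "Cod C f = Cod C g" "k \<in> Ar C" "Dom C k = Cod C g"
  shows "k \<cdot> \<langle>f, g\<rangle> = \<langle>k \<cdot> f, k \<cdot> g\<rangle>"
  by (rule coprod_eqI[of _ "Dom C f" "Dom C g" "Cod C k"]) (use assms Dom_Ob in simp_all)

text \<open>The rule \<open>comp_copair\<close> again, inside the right-nested composites that
  \<open>assoc\<close> produces. Arrows thus move into copairings until both sides of an equation
  are copairings of the same shape.\<close>

lemma comp_copair_comp [simp]:
  assumes "f \<in> Ar C" "g \<in> Ar C" "Cod C f = Cod C g" "k \<in> Ar C" "Dom C k = Cod C g"
    "x \<in> Ar C" "Cod C x = Dom C f \<amalg> Dom C g"
  shows "k \<cdot> (\<langle>f, g\<rangle> \<cdot> x) = \<langle>k \<cdot> f, k \<cdot> g\<rangle> \<cdot> x"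
  using comp_ext[OF comp_copair[OF assms(1-5)], of x] assms by simp

lemma
  assumes "f \<in> Ar C" "g \<in> Ar C"
  shows coprod_map_Ar [simp]: "f \<oplus> g \<in> Ar C"
    and dom_coprod_map [simp]: "Dom C (f \<oplus> g) = Dom C f \<amalg> Dom C g"
    and cod_coprod_map [simp]: "Cod C (f \<oplus> g) = Cod C f \<amalg> Cod C g"
  using assms Cod_Ob by (simp_all add: coprod_map_def)

lemma
  assumes "f \<in> Ar C" "g \<in> Ar C" "Dom C f = A" "Dom C g = B"
  shows coprod_map_inl [simp]: "(f \<oplus> g) \<cdot> inl C A B = inl C (Cod C f) (Cod C g) \<cdot> f"
    and coprod_map_inr [simp]: "(f \<oplus> g) \<cdot> inr C A B = inr C (Cod C f) (Cod C g) \<cdot> g"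
  using assms Cod_Ob by (simp_all add: coprod_map_def)

lemma copair_coprod_map [simp]:
  assumes "f \<in> Ar C" "g \<in> Ar C" "Cod C f = Cod C g"
    "h \<in> Ar C" "k \<in> Ar C" "Cod C h = Dom C f" "Cod C k = Dom C g"
  shows "\<langle>f, g\<rangle> \<cdot> (h \<oplus> k) = \<langle>f \<cdot> h, g \<cdot> k\<rangle>"
  by (rule coprod_eqI[of _ "Dom C h" "Dom C k" "Cod C g"]) (use assms Dom_Ob in simp_all)

lemma copair_coprod_map_comp [simp]:
  assumes "f \<in> Ar C" "g \<in> Ar C" "Cod C f = Cod C g"
    "h \<in> Ar C" "k \<in> Ar C" "Cod C h = Dom C f" "Cod C k = Dom C g"
    "x \<in> Ar C" "Cod C x = Dom C h \<amalg> Dom C k"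
  shows "\<langle>f, g\<rangle> \<cdot> ((h \<oplus> k) \<cdot> x) = \<langle>f \<cdot> h, g \<cdot> k\<rangle> \<cdot> x"
  using comp_ext[OF copair_coprod_map[OF assms(1-7)], of x] assms by simp

lemma coprod_map_Id [simp]: "A \<in> Ob C \<Longrightarrow> B \<in> Ob C \<Longrightarrow> Id C A \<oplus> Id C B = Id C (A \<amalg> B)"
  by (rule coprod_eqI[of _ A B "A \<amalg> B"]) simp_all

text \<open>The coproduct of the empty family.\<close>

lemma initial_object:
  obtains Z where "Z \<in> Ob C" "\<And>A. A \<in> Ob C \<Longrightarrow> \<exists>!z. z \<in> Hom C Z A"
proof -
  have "\<exists>Z\<in>Ob C. \<forall>A\<in>Ob C. \<exists>!z. z \<in> Hom (opp C) A Z"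
    using coproducts[unfolded has_finite_coproducts_def has_finite_products_def,
        rule_format, of "{}"] by simp
  then show thesis unfolding Hom_opp using that by blast
qed

lemma coequalizer_of_pushouts:
  assumes po: "pushouts_of_regular_epis C" and "f \<in> Hom C A B" "g \<in> Hom C A B"
  shows "\<exists>q. is_coequalizer C q f g"
proof -
  have [simp]: "A \<in> Ob C" "B \<in> Ob C" using assms Hom_Ob by blast+
  interpret op: category "opp C" by (rule category_opp)
  have "regular_epi C \<langle>h, Id C B\<rangle>" if "h \<in> Hom C A B" for h
    by (rule split_epi_regular[of _ "A \<amalg> B" B "inr C A B"]) (use that in simp_all)
  then obtain r b where "is_pushout C \<langle>f, Id C B\<rangle> \<langle>g, Id C B\<rangle> r b"
    using po assms unfolding pushouts_of_regular_epis_def by fastforce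
  then have pb: "is_pullback (opp C) r b \<langle>f, Id C B\<rangle> \<langle>g, Id C B\<rangle>" by (simp add: is_pushout_def)
  have rb: "r \<in> Hom C B (Cod C r)" "b \<in> Hom C B (Cod C r)"
    "r \<cdot> \<langle>f, Id C B\<rangle> = b \<cdot> \<langle>g, Id C B\<rangle>"
    using op.pullback_Hom[OF pb] assms by simp_all
  then have eq: "\<langle>r \<cdot> f, r\<rangle> = \<langle>b \<cdot> g, b\<rangle>" using assms by simp
  \<comment> \<open>The second summand forces the two legs of the pushout to agree; the first then
    says that this common leg coequalizes \<open>f\<close> and \<open>g\<close>.\<close>
  from arg_cong[OF eq, of "\<lambda>h. h \<cdot> inr C A B"] have [simp]: "b = r" using rb assms by simp
  from arg_cong[OF eq, of "\<lambda>h. h \<cdot> inl C A B"] have rr: "r \<cdot> f = r \<cdot> g" using rb assms by simp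
  have "is_coequalizer C r f g"
  proof (rule coequalizerI[OF assms(2,3) rb(1) rr])
    fix X h assume h: "h \<in> Hom C B X" "h \<cdot> f = h \<cdot> g"
    \<comment> \<open>Conversely, an arrow \<open>h\<close> coequalizing \<open>f\<close> and
      \<open>g\<close>, taken twice, is a cocone under the two split epimorphisms.\<close>
    have "comm_square (opp C) h h \<langle>f, Id C B\<rangle> \<langle>g, Id C B\<rangle>"
      unfolding comm_square_def using h assms by simp
    then have "\<exists>!u. u \<in> Hom (opp C) (Dom (opp C) h) (Dom (opp C) r) \<and>
        r \<cdot>\<^bsub>opp C\<^esub> u = h \<and> b \<cdot>\<^bsub>opp C\<^esub> u = h"
      using pb unfolding is_pullback_def by blast
    then show "\<exists>!u. u \<in> Hom C (Cod C r) X \<and> u \<cdot> r = h"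
      using h(1) by (simp add: Hom_opp del: Hom_def) simp
  qed
  then show ?thesis by blast
qed

end

section \<open>Regular categories\<close>

text \<open>The notion of cover used below, chosen because it composes directly. Only the triangle
  \<open>m \<cdot> v = a\<close> is required: as \<open>m\<close> is monic, \<open>v\<close> is
  unique and \<open>v \<cdot> c = w\<close> follows.\<close>

definition strong_epi :: "('o, 'a) cat \<Rightarrow> 'a \<Rightarrow> bool" where
  "strong_epi C c \<longleftrightarrow> is_epi C c \<and> c \<in> Ar C \<and>
     (\<forall>m a w. is_mono C m \<and> a \<in> Hom C (Cod C c) (Cod C m) \<and> w \<in> Hom C (Dom C c) (Dom C m) \<and>
        a \<cdot>\<^bsub>C\<^esub> c = m \<cdot>\<^bsub>C\<^esub> w \<longrightarrow>
        (\<exists>v \<in> Hom C (Cod C c) (Dom C m). m \<cdot>\<^bsub>C\<^esub> v = a))"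

context category
begin

lemma strong_epi_cancel:
  "strong_epi C c \<Longrightarrow> f \<in> Hom C (Cod C c) X \<Longrightarrow> g \<in> Hom C (Cod C c) X \<Longrightarrow> f \<cdot> c = g \<cdot> c \<Longrightarrow> f = g"
  using epi_cancel by (auto simp: strong_epi_def)

lemma strong_epi_factor:
  assumes "strong_epi C c" "is_mono C m" "m \<in> Hom C S A" "a \<in> Hom C X A" "c \<in> Hom C X' X"
    "w \<in> Hom C X' S" "a \<cdot> c = m \<cdot> w"
  obtains v where "v \<in> Hom C X S" "m \<cdot> v = a"
proof -
  have "a \<in> Hom C (Cod C c) (Cod C m)" "w \<in> Hom C (Dom C c) (Dom C m)" using assms by simp_all
  then have "\<exists>v \<in> Hom C (Cod C c) (Dom C m). m \<cdot> v = a"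
    using assms(1,2,7) unfolding strong_epi_def by blast
  then obtain v where "v \<in> Hom C (Cod C c) (Dom C m)" "m \<cdot> v = a" by (rule bexE)
  then show thesis by (intro that[of v]) (use assms(3,5) in simp_all)
qed

lemma strong_epiI:
  assumes "is_epi C c" "c \<in> Hom C X Y"
    and "\<And>m a w. is_mono C m \<Longrightarrow> a \<in> Hom C Y (Cod C m) \<Longrightarrow> w \<in> Hom C X (Dom C m) \<Longrightarrow>
      a \<cdot> c = m \<cdot> w \<Longrightarrow> \<exists>v \<in> Hom C Y (Dom C m). m \<cdot> v = a"
  shows "strong_epi C c"
  unfolding strong_epi_def
proof (intro conjI allI impI)
  show "is_epi C c" by fact
  show "c \<in> Ar C" using assms(2) by simp
  have c: "Dom C c = X" "Cod C c = Y" using assms(2) by simp_all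
  fix m a w
  assume "is_mono C m \<and> a \<in> Hom C (Cod C c) (Cod C m) \<and> w \<in> Hom C (Dom C c) (Dom C m) \<and>
    a \<cdot> c = m \<cdot> w"
  then show "\<exists>v \<in> Hom C (Cod C c) (Dom C m). m \<cdot> v = a"
    unfolding c using assms(3) by blast
qed

text \<open>If \<open>e\<close> coequalizes \<open>f\<close> and \<open>g\<close>, then
  \<open>a \<cdot> e = m \<cdot> w\<close> gives
  \<open>m \<cdot> w \<cdot> f = m \<cdot> w \<cdot> g\<close>. Cancelling \<open>m\<close>, the
  arrow \<open>w\<close> descends along \<open>e\<close> to the required diagonal.\<close>

lemma regular_epi_strong_epi:
  assumes "regular_epi C e" shows "strong_epi C e"
proof -
  obtain f g where co: "is_coequalizer C e f g" using assms by (auto simp: regular_epi_def)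
  obtain A B D where fg: "f \<in> Hom C A B" "g \<in> Hom C A B" "e \<in> Hom C B D" "e \<cdot> f = e \<cdot> g"
    using co by (rule coequalizer_arrows)
  have epi: "is_epi C e" using co by (rule coequalizer_epi)
  have "\<exists>v \<in> Hom C D (Dom C m). m \<cdot> v = a"
    if m: "is_mono C m" and a: "a \<in> Hom C D (Cod C m)" and w: "w \<in> Hom C B (Dom C m)"
      and eq: "a \<cdot> e = m \<cdot> w" for m a w
  proof -
    have mA: "m \<in> Ar C" using m by (simp add: is_mono_def)
    have "m \<cdot> (w \<cdot> f) = m \<cdot> (w \<cdot> g)"
      using comp_ext[OF eq[symmetric], of f] comp_ext[OF eq[symmetric], of g] fg mA a w by simp
    then have "w \<cdot> f = w \<cdot> g"
      using mono_cancel[OF m, of "w \<cdot> f" A "w \<cdot> g"] fg w by simp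
    then obtain v where v: "v \<in> Hom C D (Dom C m)" "v \<cdot> e = w"
      using coequalizer_factor[OF co, of w "Dom C m"] w fg by auto
    have "m \<cdot> v = a"
      by (rule epi_cancel[OF epi, of _ "Cod C m"]) (use v mA a fg eq in simp_all)
    then show ?thesis using v by blast
  qed
  then show ?thesis by (rule strong_epiI[OF epi fg(3)])
qed

text \<open>Lift first along \<open>d\<close>, then along \<open>c\<close>. Successive passages to
  covers can therefore be merged into one.\<close>

lemma strong_epi_comp:
  assumes "strong_epi C c" "strong_epi C d" "Dom C c = Cod C d"
  shows "strong_epi C (c \<cdot> d)"
proof -
  have cd [simp]: "c \<in> Ar C" "d \<in> Ar C" using assms by (simp_all add: strong_epi_def)
  have "is_epi C (c \<cdot> d)"
  proof (rule epiI)
    fix X f g assume fg: "f \<in> Hom C (Cod C c) X" "g \<in> Hom C (Cod C c) X"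
      "f \<cdot> (c \<cdot> d) = g \<cdot> (c \<cdot> d)"
    have "f \<cdot> c = g \<cdot> c"
      by (rule strong_epi_cancel[OF assms(2), of _ X]) (use fg assms(3) in simp_all)
    then show "f = g" using strong_epi_cancel[OF assms(1)] fg by blast
  qed (use assms(3) in simp)
  moreover have "\<exists>v \<in> Hom C (Cod C c) (Dom C m). m \<cdot> v = a"
    if m: "is_mono C m" and a: "a \<in> Hom C (Cod C c) (Cod C m)" and w: "w \<in> Hom C (Dom C d) (Dom C m)"
      and eq: "a \<cdot> (c \<cdot> d) = m \<cdot> w" for m a w
  proof -
    have mA: "m \<in> Ar C" using m by (simp add: is_mono_def)
    obtain v where v: "v \<in> Hom C (Cod C d) (Dom C m)" "m \<cdot> v = a \<cdot> c"
      by (rule strong_epi_factor[OF assms(2) m, of _ _ "a \<cdot> c" _ _ w])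
        (use mA a w assms(3) eq in simp_all)
    obtain v' where "v' \<in> Hom C (Cod C c) (Dom C m)" "m \<cdot> v' = a"
      by (rule strong_epi_factor[OF assms(1) m, of _ _ a _ _ v]) (use mA a v assms(3) in simp_all)
    then show ?thesis by blast
  qed
  ultimately show ?thesis
    by (intro strong_epiI[of _ "Dom C d" "Cod C c"]) (use assms(3) in simp_all)
qed

end

context regular_category
begin

lemma pullback_exists:
  assumes "r \<in> Hom C A D" "b \<in> Hom C B D"
  obtains t l P where "is_pullback C t l r b" "t \<in> Hom C P A" "l \<in> Hom C P B" "r \<cdot> t = b \<cdot> l"
proof -
  obtain t l where pb: "is_pullback C t l r b"
    by (rule pullbacks_of_finitely_complete[OF finitely_complete assms])
  show thesis by (rule that[OF pb, of "Dom C t"]) (use pullback_Hom[OF pb] assms in simp_all)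
qed

text \<open>The pullback of \<open>p\<close> along \<open>b\<close> provides the cover. In terms of
  generalized elements: an element of \<open>B\<close> comes from \<open>E\<close> after passing to
  a cover.\<close>

lemma regular_epi_lift:
  assumes "regular_epi C p" "p \<in> Hom C E B" "b \<in> Hom C X B"
  obtains c s X' where "c \<in> Hom C X' X" "strong_epi C c" "s \<in> Hom C X' E" "b \<cdot> c = p \<cdot> s"
proof -
  obtain s c P where pb: "is_pullback C s c p b" "s \<in> Hom C P E" "c \<in> Hom C P X" "p \<cdot> s = b \<cdot> c"
    using pullback_exists[OF assms(2,3)] by blast
  have "strong_epi C c" using regular_epi_stable[OF pb(1) assms(1)] by (rule regular_epi_strong_epi)
  then show thesis using that[of c P s] pb by simp
qed

lemma kernel_pair_exists:
  assumes "f \<in> Hom C A B"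
  obtains k1 k2 K where "is_kernel_pair C k1 k2 f" "k1 \<in> Hom C K A" "k2 \<in> Hom C K A" "f \<cdot> k1 = f \<cdot> k2"
  using pullback_exists[OF assms assms] unfolding is_kernel_pair_def by blast

text \<open>\<open>p\<close> is the coequalizer of some pair, which factors through the kernel pair;
  hence \<open>h\<close> coequalizes that pair too and descends.\<close>

lemma regular_epi_kernel_pair:
  assumes "regular_epi C p" "p \<in> Hom C E B" "is_kernel_pair C k1 k2 p"
    "h \<in> Hom C E X" "h \<cdot> k1 = h \<cdot> k2"
  obtains n where "n \<in> Hom C B X" "n \<cdot> p = h"
proof -
  obtain f g where co: "is_coequalizer C p f g" using assms by (auto simp: regular_epi_def)
  define A K where "A = Dom C f" and "K = Dom C k1"
  have fg: "f \<in> Hom C A E" "g \<in> Hom C A E" "p \<cdot> f = p \<cdot> g"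
    using coequalizer_Hom[OF co] assms(2) by (simp_all add: A_def)
  have k: "k1 \<in> Hom C K E" "k2 \<in> Hom C K E"
    using pullback_Hom[OF assms(3)[unfolded is_kernel_pair_def]] assms(2) by (simp_all add: K_def)
  obtain u where u: "u \<in> Hom C A K" "k1 \<cdot> u = f" "k2 \<cdot> u = g"
    by (rule pullback_factor[OF assms(3)[unfolded is_kernel_pair_def], of f A g])
      (use fg k assms(2) in simp_all)
  have "h \<cdot> (k1 \<cdot> u) = h \<cdot> (k2 \<cdot> u)" using comp_ext[OF assms(5), of u] u(1) k assms(4) by simp
  then have "h \<cdot> f = h \<cdot> g" using u by simp
  then obtain n where "n \<in> Hom C (Cod C p) X" "n \<cdot> p = h"
    by - (rule coequalizer_factor[OF co, of h X], use assms(2,4) in simp_all)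
  then show thesis by (intro that[of n]) (use assms(2) in simp_all)
qed

text \<open>\<open>e\<close> is the coequalizer of the kernel pair of \<open>k\<close>. For
  \<open>i\<close> monic, elements of \<open>I\<close> with equal image under \<open>i\<close> are
  lifted to \<open>X\<close> on a cover; the lifts form an element of the kernel pair of
  \<open>k\<close>, so \<open>e\<close> identifies them.\<close>

lemma image_factorization:
  assumes k: "k \<in> Hom C X Y"
  obtains e i I where "e \<in> Hom C X I" "i \<in> Hom C I Y" "i \<cdot> e = k" "regular_epi C e" "is_mono C i"
proof -
  obtain k1 k2 K where kp: "is_kernel_pair C k1 k2 k" "k1 \<in> Hom C K X" "k2 \<in> Hom C K X"
    "k \<cdot> k1 = k \<cdot> k2" by (rule kernel_pair_exists[OF k])
  obtain e where co: "is_coequalizer C e k1 k2" using kernel_pair_coequalizer[OF kp(1)] by blast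
  then have reg: "regular_epi C e" by (auto simp: regular_epi_def)
  define I where "I = Cod C e"
  have e: "e \<in> Hom C X I" "e \<cdot> k1 = e \<cdot> k2"
    using coequalizer_Hom[OF co] kp(2) by (simp_all add: I_def)
  obtain i where i: "i \<in> Hom C I Y" "i \<cdot> e = k"
    by (rule coequalizer_factor[OF co, of k Y]) (use e k kp in simp_all)
  have "is_mono C i"
  proof (rule monoI[OF i(1)])
    fix Z a b assume ab: "a \<in> Hom C Z I" "b \<in> Hom C Z I" "i \<cdot> a = i \<cdot> b"
    obtain c a' Z1 where c: "c \<in> Hom C Z1 Z" "strong_epi C c" "a' \<in> Hom C Z1 X" "a \<cdot> c = e \<cdot> a'"
      by (rule regular_epi_lift[OF reg e(1) ab(1)])
    have "b \<cdot> c \<in> Hom C Z1 I" using ab c by simp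
    then obtain d b' Z2 where d: "d \<in> Hom C Z2 Z1" "strong_epi C d" "b' \<in> Hom C Z2 X"
        "(b \<cdot> c) \<cdot> d = e \<cdot> b'"
      by (rule regular_epi_lift[OF reg e(1)])
    have ad: "a \<cdot> (c \<cdot> d) = e \<cdot> (a' \<cdot> d)" using comp_ext[OF c(4), of d] ab c d e by simp
    have bd: "b \<cdot> (c \<cdot> d) = e \<cdot> b'" using ab c d by simp
    have "k \<cdot> (a' \<cdot> d) = i \<cdot> (e \<cdot> (a' \<cdot> d))"
      using comp_ext[OF i(2), of "a' \<cdot> d"] i(1) e c d by simp
    also have "\<dots> = i \<cdot> (a \<cdot> (c \<cdot> d))" using ad by simp
    also have "\<dots> = i \<cdot> (b \<cdot> (c \<cdot> d))" using comp_ext[OF ab(3), of "c \<cdot> d"] ab i c d by simp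
    also have "\<dots> = k \<cdot> b'" using comp_ext[OF i(2), of b'] i(1) e c d bd by simp
    finally obtain u where u: "u \<in> Hom C Z2 K" "k1 \<cdot> u = a' \<cdot> d" "k2 \<cdot> u = b'"
      by - (rule pullback_factor[OF kp(1)[unfolded is_kernel_pair_def], of "a' \<cdot> d" Z2 b'],
          use c d k kp in simp_all)
    have "e \<cdot> (a' \<cdot> d) = e \<cdot> b'" using comp_ext[OF e(2), of u] u kp e(1) by simp
    then have "a \<cdot> (c \<cdot> d) = b \<cdot> (c \<cdot> d)" using ad bd by simp
    moreover have "strong_epi C (c \<cdot> d)" using strong_epi_comp c d by simp
    ultimately show "a = b" using strong_epi_cancel[of "c \<cdot> d" a I b] ab c d by simp
  qed
  then show thesis using that e i reg by blast
qed

text \<open>The image of \<open>(f, g)\<close> in the square of \<open>A\<close>, presented by its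
  two projections. The last clause says that membership in the relation is local: it may be checked
  on a cover, since strong epimorphisms lift against the monomorphism of the image.\<close>

lemma relation_image:
  assumes "f \<in> Hom C X A" "g \<in> Hom C X A"
  obtains e d1 d2 R where "e \<in> Hom C X R" "regular_epi C e" "d1 \<in> Hom C R A" "d2 \<in> Hom C R A"
    "d1 \<cdot> e = f" "d2 \<cdot> e = g"
    "\<And>Z x y. x \<in> Hom C Z R \<Longrightarrow> y \<in> Hom C Z R \<Longrightarrow> d1 \<cdot> x = d1 \<cdot> y \<Longrightarrow> d2 \<cdot> x = d2 \<cdot> y \<Longrightarrow> x = y"
    "\<And>Z Z' c x y w. strong_epi C c \<Longrightarrow> c \<in> Hom C Z' Z \<Longrightarrow> x \<in> Hom C Z A \<Longrightarrow> y \<in> Hom C Z A \<Longrightarrow>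
      w \<in> Hom C Z' R \<Longrightarrow> d1 \<cdot> w = x \<cdot> c \<Longrightarrow> d2 \<cdot> w = y \<cdot> c \<Longrightarrow>
      \<exists>v \<in> Hom C Z R. d1 \<cdot> v = x \<and> d2 \<cdot> v = y"
proof -
  have A: "A \<in> Ob C" using assms Hom_Ob by blast
  obtain P p q where pq: "p \<in> Hom C P A" "q \<in> Hom C P A"
    and P: "\<And>X f g. f \<in> Hom C X A \<Longrightarrow> g \<in> Hom C X A \<Longrightarrow> \<exists>!u. u \<in> Hom C X P \<and> p \<cdot> u = f \<and> q \<cdot> u = g"
    by (rule products_of_finitely_complete[OF finitely_complete A A]) (rule that)
  have P_eq: "u = v"
    if "u \<in> Hom C Z P" "v \<in> Hom C Z P" "p \<cdot> u = p \<cdot> v" "q \<cdot> u = q \<cdot> v" for Z u v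
  proof -
    have "p \<cdot> v \<in> Hom C Z A" "q \<cdot> v \<in> Hom C Z A" using that pq by simp_all
    from P[OF this] show ?thesis using that by metis
  qed
  obtain k where k: "k \<in> Hom C X P" "p \<cdot> k = f" "q \<cdot> k = g" using P[OF assms] by blast
  obtain e i R where ei: "e \<in> Hom C X R" "i \<in> Hom C R P" "i \<cdot> e = k" "regular_epi C e" "is_mono C i"
    by (rule image_factorization[OF k(1)])
  show thesis
  proof (rule that[of e R "p \<cdot> i" "q \<cdot> i"])
    show "(p \<cdot> i) \<cdot> e = f" "(q \<cdot> i) \<cdot> e = g" using pq ei k by simp_all
  next
    fix Z x y assume *: "x \<in> Hom C Z R" "y \<in> Hom C Z R" "(p \<cdot> i) \<cdot> x = (p \<cdot> i) \<cdot> y"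
      "(q \<cdot> i) \<cdot> x = (q \<cdot> i) \<cdot> y"
    have "i \<cdot> x = i \<cdot> y" by (rule P_eq[of _ Z]) (use * ei pq in simp_all)
    then show "x = y" using mono_cancel[OF ei(5)] * ei(2) by simp
  next
    fix Z Z' c x y w
    assume *: "strong_epi C c" "c \<in> Hom C Z' Z" "x \<in> Hom C Z A" "y \<in> Hom C Z A"
      "w \<in> Hom C Z' R" "(p \<cdot> i) \<cdot> w = x \<cdot> c" "(q \<cdot> i) \<cdot> w = y \<cdot> c"
    obtain u where u: "u \<in> Hom C Z P" "p \<cdot> u = x" "q \<cdot> u = y" using P[OF *(3,4)] by blast
    have "u \<cdot> c = i \<cdot> w"
      by (rule P_eq[of _ Z'])
        (use * ei pq u comp_ext[OF u(2), of c] comp_ext[OF u(3), of c] in simp_all)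
    then obtain v where v: "v \<in> Hom C Z R" "i \<cdot> v = u"
      using strong_epi_factor[OF *(1) ei(5,2) u(1) *(2,5)] by blast
    then show "\<exists>v \<in> Hom C Z R. (p \<cdot> i) \<cdot> v = x \<and> (q \<cdot> i) \<cdot> v = y"
      using u pq ei(2) by (intro bexI[of _ v]) simp_all
  qed (use pq ei in simp_all)
qed

end

section \<open>Condition P\<close>

locale exact_condition_P = exact_category +
  assumes condition_P: "condition_P C"

sublocale exact_condition_P \<subseteq> category_with_coproducts
  using condition_P by unfold_locales (simp add: condition_P_def)

context exact_condition_P
begin

lemma coprod_pullback:
  "is_pullback C t l r b \<Longrightarrow> is_pullback C t' l' r' b' \<Longrightarrow>
    is_pullback C (t \<oplus> t') (l \<oplus> l') (r \<oplus> r') (b \<oplus> b')"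
  using condition_P unfolding condition_P_def by blast

lemma coprod_pullback_lift:
  assumes "is_pullback C t l r b" "is_pullback C t' l' r' b'"
    and "x \<in> Hom C X (Dom C r \<amalg> Dom C r')" "y \<in> Hom C X (Dom C b \<amalg> Dom C b')"
    and "(r \<oplus> r') \<cdot> x = (b \<oplus> b') \<cdot> y"
  obtains u where "u \<in> Hom C X (Dom C t \<amalg> Dom C t')" "(t \<oplus> t') \<cdot> u = x" "(l \<oplus> l') \<cdot> u = y"
  by (rule pullback_factor[OF coprod_pullback[OF assms(1,2)], of x X y])
    (use assms(3-) pullback_Hom[OF assms(1)] pullback_Hom[OF assms(2)] in simp_all)

lemma coprod_map_mono:
  assumes "is_mono C m" "m \<in> Hom C S A" "is_mono C n" "n \<in> Hom C T B"
  shows "is_mono C (m \<oplus> n)"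
proof (rule pullback_mono)
  show "is_pullback C (Id C S \<oplus> Id C T) (Id C S \<oplus> Id C T) (m \<oplus> n) (m \<oplus> n)"
    by (rule coprod_pullback) (use assms mono_pullback in blast)+
  show "Id C S \<oplus> Id C T \<in> Hom C (S \<amalg> T) (S \<amalg> T)"
    using Hom_Ob(1)[OF assms(2)] Hom_Ob(1)[OF assms(4)] by simp
qed

text \<open>Condition P (d) for elements: \<open>w\<close> and \<open>e\<close> define an element of
  the pullback, and since the comparison arrow into it is a regular epimorphism, this element comes
  from \<open>E \<amalg> E\<close> on a cover.\<close>

lemma fold_lift:
  assumes "regular_epi C p" "p \<in> Hom C E B" "w \<in> Hom C X (B \<amalg> B)" "e \<in> Hom C X E"
    and "\<langle>Id C B, Id C B\<rangle> \<cdot> w = p \<cdot> e"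
  obtains c z X' where "c \<in> Hom C X' X" "strong_epi C c" "z \<in> Hom C X' (E \<amalg> E)"
    "(p \<oplus> p) \<cdot> z = w \<cdot> c" "\<langle>Id C E, Id C E\<rangle> \<cdot> z = e \<cdot> c"
proof -
  have [simp]: "E \<in> Ob C" "B \<in> Ob C" using assms(2) Hom_Ob by blast+
  have "is_feeble_pullback C (p \<oplus> p) \<langle>Id C E, Id C E\<rangle> \<langle>Id C B, Id C B\<rangle> p"
    using condition_P assms(1,2) unfolding condition_P_def by blast
  then obtain x y u where pb: "is_pullback C x y \<langle>Id C B, Id C B\<rangle> p"
    and u: "u \<in> Hom C (Dom C (p \<oplus> p)) (Dom C x)" "x \<cdot> u = p \<oplus> p" "y \<cdot> u = \<langle>Id C E, Id C E\<rangle>"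
      "regular_epi C u"
    unfolding is_feeble_pullback_def by blast
  have xy: "x \<in> Hom C (Dom C x) (B \<amalg> B)" "y \<in> Hom C (Dom C x) E"
    using pullback_Hom[OF pb] assms(2) by simp_all
  obtain v where v: "v \<in> Hom C X (Dom C x)" "x \<cdot> v = w" "y \<cdot> v = e"
    by (rule pullback_factor[OF pb, of w X e]) (use assms in simp_all)
  obtain c z X' where c: "c \<in> Hom C X' X" "strong_epi C c" "z \<in> Hom C X' (Dom C (p \<oplus> p))"
    "v \<cdot> c = u \<cdot> z"
    by (rule regular_epi_lift[OF u(4,1) v(1)])
  have "(p \<oplus> p) \<cdot> z = w \<cdot> c"
    using comp_ext[OF u(2), of z] comp_ext[OF v(2), of c] c u v xy assms(2) by simp
  moreover have "\<langle>Id C E, Id C E\<rangle> \<cdot> z = e \<cdot> c"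
    using comp_ext[OF u(3), of z] comp_ext[OF v(3), of c] c u v xy assms(2) by simp
  ultimately show thesis using that[of c X' z] c assms(2) by simp
qed

text \<open>Condition P (c) first gives a lift to \<open>S \<amalg> S\<close>. By (b), the pullback
  of \<open>Id C A \<oplus> k\<close> along \<open>m \<oplus> Id C S\<close> is
  \<open>S \<amalg> K\<close>, where the lift then lives.\<close>

lemma mono_copair_lift:
  assumes m: "is_mono C m" "m \<in> Hom C S A" and k: "k \<in> Hom C K S"
    and u: "u \<in> Hom C X (A \<amalg> K)" and x: "x \<in> Hom C X S" and eq: "\<langle>Id C A, m \<cdot> k\<rangle> \<cdot> u = m \<cdot> x"
  obtains v where "v \<in> Hom C X (S \<amalg> K)" "(m \<oplus> Id C K) \<cdot> v = u" "\<langle>Id C S, k\<rangle> \<cdot> v = x"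
proof -
  have [simp]: "A \<in> Ob C" "S \<in> Ob C" "K \<in> Ob C" using m k Hom_Ob by blast+
  have pb: "is_pullback C (m \<oplus> Id C S) \<langle>Id C S, Id C S\<rangle> \<langle>Id C A, m\<rangle> m"
    using condition_P m unfolding condition_P_def by blast
  obtain z where z: "z \<in> Hom C X (S \<amalg> S)" "(m \<oplus> Id C S) \<cdot> z = (Id C A \<oplus> k) \<cdot> u"
      "\<langle>Id C S, Id C S\<rangle> \<cdot> z = x"
    by (rule pullback_factor[OF pb, of "(Id C A \<oplus> k) \<cdot> u" X x]) (use m k u x eq in simp_all)
  obtain v where v: "v \<in> Hom C X (S \<amalg> K)" "(m \<oplus> Id C K) \<cdot> v = u" "(Id C S \<oplus> k) \<cdot> v = z"
    by (rule coprod_pullback_lift[OF pullback_Id_left[OF m(2)] pullback_Id_right[OF k], of u X z])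
      (use m k u z in simp_all)
  have "\<langle>Id C S, k\<rangle> \<cdot> v = x"
    unfolding z(3)[symmetric] v(3)[symmetric] using v(1) k by simp
  then show thesis using that v by blast
qed

text \<open>With \<open>Z\<close> initial, \<open>inl C A B\<close> is
  \<open>Id C A \<oplus> zB\<close> after the injection of \<open>A\<close> into
  \<open>A \<amalg> Z\<close>. In this form (b) computes its pullback along
  \<open>m \<oplus> Id C B\<close> as \<open>S \<amalg> Z\<close>.\<close>

lemma inl_lift:
  assumes m: "m \<in> Hom C S A" and B: "B \<in> Ob C" and h: "h \<in> Hom C X A"
    and w: "w \<in> Hom C X (S \<amalg> B)" and eq: "inl C A B \<cdot> h = (m \<oplus> Id C B) \<cdot> w"
  obtains v where "v \<in> Hom C X S" "m \<cdot> v = h"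
proof -
  have Ob [simp]: "A \<in> Ob C" "B \<in> Ob C" "S \<in> Ob C" using m B Hom_Ob by blast+
  obtain Z where Z [simp]: "Z \<in> Ob C" and initial: "\<And>A. A \<in> Ob C \<Longrightarrow> \<exists>!z. z \<in> Hom C Z A"
    by (rule initial_object) (rule that)
  obtain zA zB zS where z: "zA \<in> Hom C Z A" "zB \<in> Hom C Z B" "zS \<in> Hom C Z S"
    using initial Ob by meson
  have zm: "m \<cdot> zS = zA" using initial[OF Ob(1)] z m by fastforce
  have "(Id C A \<oplus> zB) \<cdot> (inl C A Z \<cdot> h) = (m \<oplus> Id C B) \<cdot> w"
    unfolding eq[symmetric] using comp_ext[OF coprod_map_inl[of "Id C A" zB A Z], of h] z h by simp
  then obtain u where u: "u \<in> Hom C X (S \<amalg> Z)" "(m \<oplus> Id C Z) \<cdot> u = inl C A Z \<cdot> h"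
    using coprod_pullback_lift[OF pullback_Id_left[OF m] pullback_Id_right[OF z(2)],
        of "inl C A Z \<cdot> h" X w] m z w h by auto
  \<comment> \<open>The summand \<open>Z\<close> is collapsed again by the unique arrows out of it;
    \<open>m \<cdot> zS = zA\<close> makes the collapse commute with \<open>m\<close>.\<close>
  have "h = \<langle>Id C A, zA\<rangle> \<cdot> ((m \<oplus> Id C Z) \<cdot> u)" using u(2) z h by simp
  also have "\<dots> = m \<cdot> (\<langle>Id C S, zS\<rangle> \<cdot> u)" using u(1) z m by (simp add: zm)
  finally show thesis using that[of "\<langle>Id C S, zS\<rangle> \<cdot> u"] u(1) z m by simp
qed

end

section \<open>Carrying the kernel pair of a regular epimorphism along a monomorphism\<close>

locale mono_and_regular_epi = exact_condition_P +
  fixes m p k1 k2 S A B K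
  assumes m: "is_mono C m" "m \<in> Hom C S A"
    and p: "regular_epi C p" "p \<in> Hom C S B"
    and kernel: "is_kernel_pair C k1 k2 p" and k: "k1 \<in> Hom C K S" "k2 \<in> Hom C K S"
begin

text \<open>An element of \<open>A \<amalg> K\<close> is a step from its value under
  \<open>f1\<close> to its value under \<open>f2\<close>: trivial on \<open>A\<close>, a step of the
  kernel pair moved along \<open>m\<close> on \<open>K\<close>.\<close>

abbreviation "f1 \<equiv> \<langle>Id C A, m \<cdot> k1\<rangle>"
abbreviation "f2 \<equiv> \<langle>Id C A, m \<cdot> k2\<rangle>"

lemma objects [simp]: "A \<in> Ob C" "S \<in> Ob C" "B \<in> Ob C" "K \<in> Ob C"
  using m p k Hom_Ob by blast+

lemmas typing = m(2)[simplified] p(2)[simplified] k[simplified]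

lemma pk: "p \<cdot> k1 = p \<cdot> k2"
  using pullback_Hom[OF kernel[unfolded is_kernel_pair_def]] by simp

lemma kernel_lift:
  assumes "x \<in> Hom C X S" "y \<in> Hom C X S" "p \<cdot> x = p \<cdot> y"
  obtains u where "u \<in> Hom C X K" "k1 \<cdot> u = x" "k2 \<cdot> u = y"
  by (rule pullback_factor[OF kernel[unfolded is_kernel_pair_def], of x X y])
    (use assms typing in simp_all)

text \<open>The diagonal of the kernel pair is a section; Condition P (d) will be applied to
  \<open>k2\<close>.\<close>

lemma regular_epi_k2: "regular_epi C k2"
proof -
  obtain d where "d \<in> Hom C S K" "k1 \<cdot> d = Id C S" "k2 \<cdot> d = Id C S"
    by (rule kernel_lift[of "Id C S" S "Id C S"]) simp_all
  then show ?thesis using split_epi_regular k by blast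
qed

text \<open>Composing a step \<open>t2\<close> in \<open>K\<close> with a step \<open>t1\<close> in
  \<open>A \<amalg> K\<close>. On a cover, the situation splits over \<open>K\<close>, where
  \<open>t1\<close> is trivial, and over \<open>L\<close>, the pairs of composable steps of the
  kernel pair.\<close>

lemma composite_lift_kernel:
  assumes t: "t1 \<in> Hom C T (A \<amalg> K)" "t2 \<in> Hom C T K" and eq: "f1 \<cdot> t1 = m \<cdot> (k2 \<cdot> t2)"
  obtains c w T' where "c \<in> Hom C T' T" "strong_epi C c" "w \<in> Hom C T' (A \<amalg> K)"
    "f1 \<cdot> w = m \<cdot> (k1 \<cdot> (t2 \<cdot> c))" "f2 \<cdot> w = f2 \<cdot> (t1 \<cdot> c)"
proof -
  have "k2 \<cdot> t2 \<in> Hom C T S" using t typing by simp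
  \<comment> \<open>The start of \<open>t1\<close> lies in the subobject \<open>S\<close>, so
    \<open>t1\<close> comes from \<open>S \<amalg> K\<close>.\<close>
  then obtain t' where t': "t' \<in> Hom C T (S \<amalg> K)" "(m \<oplus> Id C K) \<cdot> t' = t1"
      "\<langle>Id C S, k1\<rangle> \<cdot> t' = k2 \<cdot> t2"
    by (rule mono_copair_lift[OF m k(1) t(1) _ eq])
  \<comment> \<open>Condition P (d) for \<open>k2\<close> splits \<open>t2\<close> along the
    decomposition of \<open>t'\<close>.\<close>
  obtain c z T' where c: "c \<in> Hom C T' T" "strong_epi C c" "z \<in> Hom C T' (K \<amalg> K)"
      "(k2 \<oplus> k2) \<cdot> z = ((Id C S \<oplus> k1) \<cdot> t') \<cdot> c" "\<langle>Id C K, Id C K\<rangle> \<cdot> z = t2 \<cdot> c"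
    by (rule fold_lift[OF regular_epi_k2 k(2), of "(Id C S \<oplus> k1) \<cdot> t'" T t2])
      (use t t' typing in simp_all)
  obtain l2 l1 L where L: "is_pullback C l2 l1 k1 k2" "l2 \<in> Hom C L K" "l1 \<in> Hom C L K"
      "k1 \<cdot> l2 = k2 \<cdot> l1"
    by (rule pullback_exists[OF k])
  obtain y where y: "y \<in> Hom C T' (K \<amalg> L)" "(k2 \<oplus> l2) \<cdot> y = t' \<cdot> c" "(Id C K \<oplus> l1) \<cdot> y = z"
    by (rule coprod_pullback_lift[OF pullback_Id_left[OF k(2)] L(1), of "t' \<cdot> c" T' z])
      (use L c t' typing in simp_all)
  have "p \<cdot> (k1 \<cdot> l1) = p \<cdot> (k2 \<cdot> l2)"
    using comp_ext[OF pk, of l1] comp_ext[OF pk, of l2] L typing by simp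
  \<comment> \<open>\<open>r\<close> composes the two steps in \<open>L\<close>, by transitivity of
    the kernel pair.\<close>
  then obtain r where r: "r \<in> Hom C L K" "k1 \<cdot> r = k1 \<cdot> l1" "k2 \<cdot> r = k2 \<cdot> l2"
    by - (rule kernel_lift[of "k1 \<cdot> l1" L "k2 \<cdot> l2"], use L typing in simp_all)
  have "L \<in> Ob C" using L Hom_Ob by blast
  note simps = typing L(2,3) r c(1,3) y(1) t t'(1) this
  show thesis
  \<comment> \<open>The composite is the given step on the summand \<open>K\<close> and
    \<open>r\<close> on \<open>L\<close>; both are placed in the summand \<open>K\<close> of
    \<open>A \<amalg> K\<close>.\<close>
  proof (rule that[OF c(1,2), of "\<langle>inr C A K, inr C A K \<cdot> r\<rangle> \<cdot> y"])
    show "f1 \<cdot> (\<langle>inr C A K, inr C A K \<cdot> r\<rangle> \<cdot> y) = m \<cdot> (k1 \<cdot> (t2 \<cdot> c))"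
      unfolding c(5)[symmetric] y(3)[symmetric] using simps by simp
    have "f2 \<cdot> (t1 \<cdot> c) = \<langle>m, m \<cdot> k2\<rangle> \<cdot> (t' \<cdot> c)" unfolding t'(2)[symmetric] using simps by simp
    then show "f2 \<cdot> (\<langle>inr C A K, inr C A K \<cdot> r\<rangle> \<cdot> y) = f2 \<cdot> (t1 \<cdot> c)"
      unfolding y(2)[symmetric] using simps by simp
  qed (use simps in simp)
qed

text \<open>Composing arbitrary steps \<open>u\<close> and \<open>v\<close>. On a cover the pair
  splits over \<open>A \<amalg> K\<close>, where \<open>u\<close> is trivial, and over
  \<open>T\<close>, where \<open>u\<close> lies in \<open>K\<close> and
  \<open>composite_lift_kernel\<close> applies.\<close>

lemma composite_lift:
  assumes R: "e \<in> Hom C (A \<amalg> K) R" "d1 \<in> Hom C R A" "d2 \<in> Hom C R A" "d1 \<cdot> e = f1" "d2 \<cdot> e = f2"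
    and descend: "\<And>Z Z' c x y w. strong_epi C c \<Longrightarrow> c \<in> Hom C Z' Z \<Longrightarrow> x \<in> Hom C Z A \<Longrightarrow>
      y \<in> Hom C Z A \<Longrightarrow> w \<in> Hom C Z' R \<Longrightarrow> d1 \<cdot> w = x \<cdot> c \<Longrightarrow> d2 \<cdot> w = y \<cdot> c \<Longrightarrow>
      \<exists>v \<in> Hom C Z R. d1 \<cdot> v = x \<and> d2 \<cdot> v = y"
    and uv: "u \<in> Hom C X (A \<amalg> K)" "v \<in> Hom C X (A \<amalg> K)" "f2 \<cdot> u = f1 \<cdot> v"
  obtains w where "w \<in> Hom C X R" "d1 \<cdot> w = f1 \<cdot> u" "d2 \<cdot> w = f2 \<cdot> v"
proof -
  have f1: "f1 \<in> Hom C (A \<amalg> K) A" and f2: "f2 \<in> Hom C (A \<amalg> K) A" and mk2: "m \<cdot> k2 \<in> Hom C K A"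
    using typing by simp_all
  have reg: "regular_epi C f1"
    by (rule split_epi_regular[OF f1, of "inl C A K"]) (use typing in simp_all)
  obtain c z X' where c: "c \<in> Hom C X' X" "strong_epi C c" "z \<in> Hom C X' ((A \<amalg> K) \<amalg> (A \<amalg> K))"
      "(f1 \<oplus> f1) \<cdot> z = ((Id C A \<oplus> (m \<cdot> k2)) \<cdot> u) \<cdot> c"
      "\<langle>Id C (A \<amalg> K), Id C (A \<amalg> K)\<rangle> \<cdot> z = v \<cdot> c"
    by (rule fold_lift[OF reg f1, of "(Id C A \<oplus> (m \<cdot> k2)) \<cdot> u" X v]) (use uv typing in simp_all)
  obtain t2 t1 T where T: "is_pullback C t2 t1 (m \<cdot> k2) f1" "t2 \<in> Hom C T K"
      "t1 \<in> Hom C T (A \<amalg> K)" "(m \<cdot> k2) \<cdot> t2 = f1 \<cdot> t1"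
    by (rule pullback_exists[OF mk2 f1])
  obtain y where y: "y \<in> Hom C X' ((A \<amalg> K) \<amalg> T)" "(f1 \<oplus> t2) \<cdot> y = u \<cdot> c"
      "(Id C (A \<amalg> K) \<oplus> t1) \<cdot> y = z"
    by (rule coprod_pullback_lift[OF pullback_Id_left[OF f1] T(1), of "u \<cdot> c" X' z])
      (use T c uv typing in simp_all)
  have "f1 \<cdot> t1 = m \<cdot> (k2 \<cdot> t2)" using T typing by simp
  then obtain c' w T' where c': "c' \<in> Hom C T' T" "strong_epi C c'" "w \<in> Hom C T' (A \<amalg> K)"
      "f1 \<cdot> w = m \<cdot> (k1 \<cdot> (t2 \<cdot> c'))" "f2 \<cdot> w = f2 \<cdot> (t1 \<cdot> c')"
    by (rule composite_lift_kernel[OF T(3,2)])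
  \<comment> \<open>On \<open>T\<close> the composite was found only on a cover; membership in
    \<open>R\<close> being local, it descends.\<close>
  have "\<exists>r \<in> Hom C T R. d1 \<cdot> r = m \<cdot> (k1 \<cdot> t2) \<and> d2 \<cdot> r = f2 \<cdot> t1"
    by (rule descend[OF c'(2,1), of _ _ "e \<cdot> w"])
      (use R c' T(2,3) typing comp_ext[OF R(4), of w] comp_ext[OF R(5), of w] in simp_all)
  then obtain r where r: "r \<in> Hom C T R" "d1 \<cdot> r = m \<cdot> (k1 \<cdot> t2)" "d2 \<cdot> r = f2 \<cdot> t1" by blast
  have "T \<in> Ob C" using T Hom_Ob by blast
  note simps = typing T(2,3) R r y(1) c(1,3) uv(1,2) this
  \<comment> \<open>Where \<open>u\<close> is trivial the composite is \<open>v\<close> itself,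
    represented in \<open>R\<close> by \<open>e\<close>; on \<open>T\<close> it is
    \<open>r\<close>.\<close>
  have "d1 \<cdot> (\<langle>e, r\<rangle> \<cdot> y) = f1 \<cdot> (u \<cdot> c)"
    unfolding y(2)[symmetric] using simps by simp
  moreover have "f2 \<cdot> (v \<cdot> c) = \<langle>f2, f2\<rangle> \<cdot> z"
    unfolding c(5)[symmetric] using simps by simp
  then have "d2 \<cdot> (\<langle>e, r\<rangle> \<cdot> y) = f2 \<cdot> (v \<cdot> c)"
    unfolding y(3)[symmetric] using simps by simp
  ultimately have "\<exists>w \<in> Hom C X R. d1 \<cdot> w = f1 \<cdot> u \<and> d2 \<cdot> w = f2 \<cdot> v"
    by (intro descend[OF c(2,1), of _ _ "\<langle>e, r\<rangle> \<cdot> y"]) (use simps in simp_all)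
  then show thesis using that by blast
qed

lemma kernel_relation:
  obtains e d1 d2 R where "e \<in> Hom C (A \<amalg> K) R" "regular_epi C e" "d1 \<in> Hom C R A" "d2 \<in> Hom C R A"
    "d1 \<cdot> e = f1" "d2 \<cdot> e = f2" "internal_equivalence C A d1 d2"
proof -
  have f1: "f1 \<in> Hom C (A \<amalg> K) A" and f2: "f2 \<in> Hom C (A \<amalg> K) A" using typing by simp_all
  obtain e d1 d2 R where e: "e \<in> Hom C (A \<amalg> K) R" "regular_epi C e"
    and d: "d1 \<in> Hom C R A" "d2 \<in> Hom C R A" and de: "d1 \<cdot> e = f1" "d2 \<cdot> e = f2"
    and jm: "\<And>Z x y. x \<in> Hom C Z R \<Longrightarrow> y \<in> Hom C Z R \<Longrightarrow> d1 \<cdot> x = d1 \<cdot> y \<Longrightarrow>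
      d2 \<cdot> x = d2 \<cdot> y \<Longrightarrow> x = y"
    and descend: "\<And>Z Z' c x y w. strong_epi C c \<Longrightarrow> c \<in> Hom C Z' Z \<Longrightarrow> x \<in> Hom C Z A \<Longrightarrow>
      y \<in> Hom C Z A \<Longrightarrow> w \<in> Hom C Z' R \<Longrightarrow> d1 \<cdot> w = x \<cdot> c \<Longrightarrow> d2 \<cdot> w = y \<cdot> c \<Longrightarrow>
      \<exists>v \<in> Hom C Z R. d1 \<cdot> v = x \<and> d2 \<cdot> v = y"
    by (rule relation_image[OF f1 f2]) (rule that)
  note de_ext = comp_ext[OF de(1)] comp_ext[OF de(2)]
  have "internal_equivalence C A d1 d2"
    unfolding internal_equivalence_def
  proof (intro exI[of _ R] conjI)
    show "\<forall>X. \<forall>f\<in>Hom C X R. \<forall>g\<in>Hom C X R. d1 \<cdot> f = d1 \<cdot> g \<and> d2 \<cdot> f = d2 \<cdot> g \<longrightarrow> f = g"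
      using jm by blast
    show "\<exists>r\<in>Hom C A R. d1 \<cdot> r = Id C A \<and> d2 \<cdot> r = Id C A"
      by (rule bexI[of _ "e \<cdot> inl C A K"]) (use e d de_ext typing in simp_all)
    \<comment> \<open>The kernel pair is symmetric, so \<open>Id C A \<oplus> s\<close> interchanges
      \<open>f1\<close> and \<open>f2\<close>; symmetry of \<open>R\<close> follows by descent along
      the cover \<open>e\<close>.\<close>
    obtain s where s: "s \<in> Hom C K K" "k1 \<cdot> s = k2" "k2 \<cdot> s = k1"
      by (rule kernel_lift[OF k(2,1)]) (use pk in simp_all)
    show "\<exists>s\<in>Hom C R R. d1 \<cdot> s = d2 \<and> d2 \<cdot> s = d1"
      by (rule descend[OF regular_epi_strong_epi[OF e(2)] e(1) d(2,1), of "e \<cdot> (Id C A \<oplus> s)"])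
        (use e d de de_ext s typing in simp_all)
    show "\<forall>q1 q2. is_pullback C q1 q2 d2 d1 \<longrightarrow>
        (\<exists>t\<in>Hom C (Dom C q1) R. d1 \<cdot> t = d1 \<cdot> q1 \<and> d2 \<cdot> t = d2 \<cdot> q2)"
    proof (intro allI impI)
      fix q1 q2 assume pb: "is_pullback C q1 q2 d2 d1"
      define Q where "Q = Dom C q1"
      have q: "q1 \<in> Hom C Q R" "q2 \<in> Hom C Q R" "d2 \<cdot> q1 = d1 \<cdot> q2"
        using pullback_Hom[OF pb] d by (simp_all add: Q_def)
      \<comment> \<open>Composable elements of \<open>R\<close> are lifted to steps in
        \<open>A \<amalg> K\<close> on a cover, composed there, and the result is descended.\<close>
      obtain c u Q1 where c: "c \<in> Hom C Q1 Q" "strong_epi C c" "u \<in> Hom C Q1 (A \<amalg> K)" "q1 \<cdot> c = e \<cdot> u"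
        by (rule regular_epi_lift[OF e(2,1) q(1)])
      have "q2 \<cdot> c \<in> Hom C Q1 R" using q c by simp
      then obtain c' v Q2 where c': "c' \<in> Hom C Q2 Q1" "strong_epi C c'" "v \<in> Hom C Q2 (A \<amalg> K)"
          "(q2 \<cdot> c) \<cdot> c' = e \<cdot> v"
        by (rule regular_epi_lift[OF e(2,1)])
      have q1c: "q1 \<cdot> (c \<cdot> c') = e \<cdot> (u \<cdot> c')" using comp_ext[OF c(4), of c'] q c c' e by simp
      have q2c: "q2 \<cdot> (c \<cdot> c') = e \<cdot> v" using q c c' by simp
      have "f2 \<cdot> (u \<cdot> c') = d2 \<cdot> (q1 \<cdot> (c \<cdot> c'))"
        unfolding q1c using de_ext(2)[of "u \<cdot> c'"] c c' e d by simp
      also have "\<dots> = d1 \<cdot> (q2 \<cdot> (c \<cdot> c'))" using comp_ext[OF q(3), of "c \<cdot> c'"] q c c' d by simp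
      also have "\<dots> = f1 \<cdot> v" unfolding q2c using de_ext(1)[of v] c' e d by simp
      finally obtain w where w: "w \<in> Hom C Q2 R" "d1 \<cdot> w = f1 \<cdot> (u \<cdot> c')" "d2 \<cdot> w = f2 \<cdot> v"
        by - (rule composite_lift[OF e(1) d de descend, where u = "u \<cdot> c'" and X = Q2 and v = v],
            use c c' in simp_all)
      have cc': "strong_epi C (c \<cdot> c')" "c \<cdot> c' \<in> Hom C Q2 Q" using strong_epi_comp c c' by simp_all
      have "d1 \<cdot> w = (d1 \<cdot> q1) \<cdot> (c \<cdot> c')"
        using w(2) q1c de_ext(1)[of "u \<cdot> c'"] q c c' e d by simp
      moreover have "d2 \<cdot> w = (d2 \<cdot> q2) \<cdot> (c \<cdot> c')"
        using w(3) q2c de_ext(2)[of v] q c c' e d by simp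
      moreover have "d1 \<cdot> q1 \<in> Hom C Q A" "d2 \<cdot> q2 \<in> Hom C Q A" using q d by simp_all
      ultimately show "\<exists>t\<in>Hom C (Dom C q1) R. d1 \<cdot> t = d1 \<cdot> q1 \<and> d2 \<cdot> t = d2 \<cdot> q2"
        using descend[OF cc' _ _ w(1)] unfolding Q_def by blast
    qed
  qed (use d in simp_all)
  then show thesis using that e d de by blast
qed

text \<open>The last clause carries the pullback property: from
  \<open>q \<cdot> m = n \<cdot> p\<close> and monicity of \<open>m\<close> and \<open>n\<close>,
  the lift \<open>v\<close> is unique and \<open>p \<cdot> v = b\<close>.\<close>

lemma mono_regular_epi_square:
  obtains q n F where "q \<in> Hom C A F" "n \<in> Hom C B F" "q \<cdot> m = n \<cdot> p" "is_mono C n"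
    "\<And>X a b. a \<in> Hom C X A \<Longrightarrow> b \<in> Hom C X B \<Longrightarrow> q \<cdot> a = n \<cdot> b \<Longrightarrow> \<exists>v \<in> Hom C X S. m \<cdot> v = a"
proof -
  obtain e d1 d2 R where e: "e \<in> Hom C (A \<amalg> K) R" "regular_epi C e"
    and d: "d1 \<in> Hom C R A" "d2 \<in> Hom C R A" and de: "d1 \<cdot> e = f1" "d2 \<cdot> e = f2"
    and eq: "internal_equivalence C A d1 d2" by (rule kernel_relation)
  note de_ext = comp_ext[OF de(1)] comp_ext[OF de(2)]
  obtain q where kq: "is_kernel_pair C d1 d2 q" using effective[OF eq] by blast
  define F where "F = Cod C q"
  have q: "q \<in> Hom C A F" "q \<cdot> d1 = q \<cdot> d2"
    using pullback_Hom[OF kq[unfolded is_kernel_pair_def]] d by (simp_all add: F_def)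
  \<comment> \<open>On the summand \<open>K\<close>, the relation \<open>R\<close> consists of the
    pairs \<open>(m \<cdot> k1, m \<cdot> k2)\<close>; hence \<open>q \<cdot> m\<close> descends
    along \<open>p\<close>.\<close>
  have "q \<cdot> (d1 \<cdot> (e \<cdot> inr C A K)) = q \<cdot> (d2 \<cdot> (e \<cdot> inr C A K))"
    using comp_ext[OF q(2), of "e \<cdot> inr C A K"] q d e by simp
  then have "(q \<cdot> m) \<cdot> k1 = (q \<cdot> m) \<cdot> k2"
    using de_ext[of "inr C A K"] e d q typing by simp
  then obtain n where n: "n \<in> Hom C B F" "n \<cdot> p = q \<cdot> m"
    using regular_epi_kernel_pair[OF p kernel, of "q \<cdot> m" F] q m by auto
  \<comment> \<open>If \<open>q\<close> identifies \<open>a\<close> with an element of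
    \<open>S\<close>, then on a cover they are joined by a step ending in \<open>S\<close>. Such a
    step comes from \<open>S \<amalg> K\<close>, so \<open>a\<close> also lies in \<open>S\<close>
    there, with the same image under \<open>p\<close>.\<close>
  have lift: "\<exists>c t X'. strong_epi C c \<and> c \<in> Hom C X' X \<and> t \<in> Hom C X' S \<and> a \<cdot> c = m \<cdot> t \<and>
      p \<cdot> t = p \<cdot> (s \<cdot> c)"
    if a: "a \<in> Hom C X A" and s: "s \<in> Hom C X S" and as: "q \<cdot> a = q \<cdot> (m \<cdot> s)" for X a s
  proof -
    obtain r where r: "r \<in> Hom C X R" "d1 \<cdot> r = a" "d2 \<cdot> r = m \<cdot> s"
      by (rule pullback_factor[OF kq[unfolded is_kernel_pair_def], of a X "m \<cdot> s"])
        (use a s as d q typing in simp_all)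
    obtain c u X' where c: "c \<in> Hom C X' X" "strong_epi C c" "u \<in> Hom C X' (A \<amalg> K)" "r \<cdot> c = e \<cdot> u"
      by (rule regular_epi_lift[OF e(2,1) r(1)])
    have f1u: "f1 \<cdot> u = a \<cdot> c"
      using de_ext(1)[of u] comp_ext[OF r(2), of c] c r e d by simp
    have "f2 \<cdot> u = m \<cdot> (s \<cdot> c)"
      using de_ext(2)[of u] comp_ext[OF r(3), of c] c r e d s typing by simp
    moreover have "s \<cdot> c \<in> Hom C X' S" using s c by simp
    ultimately obtain v where v: "v \<in> Hom C X' (S \<amalg> K)" "(m \<oplus> Id C K) \<cdot> v = u" "\<langle>Id C S, k2\<rangle> \<cdot> v = s \<cdot> c"
      using mono_copair_lift[OF m k(2) c(3)] by blast
    have "a \<cdot> c = m \<cdot> (\<langle>Id C S, k1\<rangle> \<cdot> v)"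
      unfolding f1u[symmetric] v(2)[symmetric] using v(1) typing by simp
    moreover have "p \<cdot> (\<langle>Id C S, k1\<rangle> \<cdot> v) = p \<cdot> (s \<cdot> c)"
      unfolding v(3)[symmetric] using v(1) typing pk by simp
    moreover have "\<langle>Id C S, k1\<rangle> \<cdot> v \<in> Hom C X' S" using v(1) typing by simp
    ultimately show ?thesis using c(1,2) by blast
  qed
  note np_ext = comp_ext[OF n(2)]
  have "is_mono C n"
  proof (rule monoI[OF n(1)])
    fix X x y assume xy: "x \<in> Hom C X B" "y \<in> Hom C X B" "n \<cdot> x = n \<cdot> y"
    obtain c s X1 where c: "c \<in> Hom C X1 X" "strong_epi C c" "s \<in> Hom C X1 S" "x \<cdot> c = p \<cdot> s"
      by (rule regular_epi_lift[OF p xy(1)])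
    have "y \<cdot> c \<in> Hom C X1 B" using xy c by simp
    then obtain c' t X2 where c': "c' \<in> Hom C X2 X1" "strong_epi C c'" "t \<in> Hom C X2 S"
        "(y \<cdot> c) \<cdot> c' = p \<cdot> t"
      by (rule regular_epi_lift[OF p])
    have xc: "x \<cdot> (c \<cdot> c') = p \<cdot> (s \<cdot> c')" using comp_ext[OF c(4), of c'] xy c c' typing by simp
    have yc: "y \<cdot> (c \<cdot> c') = p \<cdot> t" using xy c c' by simp
    have "q \<cdot> (m \<cdot> (s \<cdot> c')) = n \<cdot> (x \<cdot> (c \<cdot> c'))"
      unfolding xc using np_ext[of "s \<cdot> c'"] q n c c' typing by simp
    also have "\<dots> = n \<cdot> (y \<cdot> (c \<cdot> c'))" using comp_ext[OF xy(3), of "c \<cdot> c'"] xy n c c' by simp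
    also have "\<dots> = q \<cdot> (m \<cdot> t)" unfolding yc using np_ext[of t] q n c' typing by simp
    \<comment> \<open>Here \<open>lift\<close> is applied to two elements of \<open>S\<close>,
      lifting \<open>x\<close> and \<open>y\<close>; cancelling \<open>m\<close> shows that their
      images under \<open>p\<close> agree.\<close>
    finally obtain c'' t' X3 where c'': "strong_epi C c''" "c'' \<in> Hom C X3 X2" "t' \<in> Hom C X3 S"
        "(m \<cdot> (s \<cdot> c')) \<cdot> c'' = m \<cdot> t'" "p \<cdot> t' = p \<cdot> (t \<cdot> c'')"
      using lift[of "m \<cdot> (s \<cdot> c')" X2 t] c c' typing by auto
    have "s \<cdot> (c' \<cdot> c'') = t'"
      by (rule mono_cancel[OF m(1), of _ X3]) (use c c' c'' typing in simp_all)
    then have "p \<cdot> (s \<cdot> (c' \<cdot> c'')) = p \<cdot> (t \<cdot> c'')" using c'' by simp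
    then have "x \<cdot> (c \<cdot> (c' \<cdot> c'')) = y \<cdot> (c \<cdot> (c' \<cdot> c''))"
      using comp_ext[OF xc, of c''] comp_ext[OF yc, of c''] xy c c' c'' typing by simp
    moreover have "strong_epi C (c \<cdot> (c' \<cdot> c''))" using strong_epi_comp c c' c'' by simp
    ultimately show "x = y"
      using strong_epi_cancel[of "c \<cdot> (c' \<cdot> c'')" x B y] xy c c' c'' by simp
  qed
  moreover have "\<exists>v \<in> Hom C X S. m \<cdot> v = a"
    if ab: "a \<in> Hom C X A" "b \<in> Hom C X B" "q \<cdot> a = n \<cdot> b" for X a b
  proof -
    obtain c s X1 where c: "c \<in> Hom C X1 X" "strong_epi C c" "s \<in> Hom C X1 S" "b \<cdot> c = p \<cdot> s"
      by (rule regular_epi_lift[OF p ab(2)])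
    have "q \<cdot> (a \<cdot> c) = n \<cdot> (b \<cdot> c)" using comp_ext[OF ab(3), of c] ab q n c by simp
    also have "\<dots> = q \<cdot> (m \<cdot> s)" unfolding c(4) using np_ext[of s] q n c typing by simp
    finally obtain c' t X2 where c': "strong_epi C c'" "c' \<in> Hom C X2 X1" "t \<in> Hom C X2 S"
        "(a \<cdot> c) \<cdot> c' = m \<cdot> t"
      using lift[of "a \<cdot> c" X1 s] ab c by auto
    have "strong_epi C (c \<cdot> c')" using strong_epi_comp c c' by simp
    then obtain v where "v \<in> Hom C X S" "m \<cdot> v = a"
      by (rule strong_epi_factor[OF _ m ab(1), of _ X2 t]) (use ab c c' in simp_all)
    then show ?thesis by blast
  qed
  ultimately show thesis using that[of q F n] q n by simp
qed

end

section \<open>Regularity of monomorphisms, their stability under pushout, and coregularity\<close>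

context exact_condition_P
begin

text \<open>Replacing \<open>f\<close> by the split epimorphism
  \<open>\<langle>f, Id C B\<rangle>\<close> and \<open>m\<close> by
  \<open>m \<oplus> Id C B\<close> reduces to the preceding construction; \<open>i\<close> is the
  restriction of \<open>q\<close> to \<open>A\<close>.\<close>

lemma mono_pushout_square:
  assumes m: "is_mono C m" "m \<in> Hom C S A" and f: "f \<in> Hom C S B"
  obtains i n F where "i \<in> Hom C A F" "n \<in> Hom C B F" "i \<cdot> m = n \<cdot> f" "is_mono C n"
    "\<And>X a b. a \<in> Hom C X A \<Longrightarrow> b \<in> Hom C X B \<Longrightarrow> i \<cdot> a = n \<cdot> b \<Longrightarrow> \<exists>v \<in> Hom C X S. m \<cdot> v = a"
proof -
  have [simp]: "A \<in> Ob C" "B \<in> Ob C" "S \<in> Ob C" using m f Hom_Ob by blast+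
  have Id_mono: "is_mono C (Id C B)" by (rule monoI[of _ B B]) simp_all
  have reg: "regular_epi C \<langle>f, Id C B\<rangle>"
    by (rule split_epi_regular[of _ "S \<amalg> B" B "inr C S B"]) (use f in simp_all)
  have p: "\<langle>f, Id C B\<rangle> \<in> Hom C (S \<amalg> B) B" using f by simp
  obtain k1 k2 K where k: "is_kernel_pair C k1 k2 \<langle>f, Id C B\<rangle>" "k1 \<in> Hom C K (S \<amalg> B)"
      "k2 \<in> Hom C K (S \<amalg> B)"
    by (rule kernel_pair_exists[OF p])
  interpret sq: mono_and_regular_epi C "m \<oplus> Id C B" "\<langle>f, Id C B\<rangle>" k1 k2 "S \<amalg> B" "A \<amalg> B" B K
    by unfold_locales (use coprod_map_mono[OF m Id_mono] m reg p k in simp_all)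
  obtain q n F where q: "q \<in> Hom C (A \<amalg> B) F" "n \<in> Hom C B F"
      "q \<cdot> (m \<oplus> Id C B) = n \<cdot> \<langle>f, Id C B\<rangle>" "is_mono C n"
    and lift: "\<And>X a b. a \<in> Hom C X (A \<amalg> B) \<Longrightarrow> b \<in> Hom C X B \<Longrightarrow> q \<cdot> a = n \<cdot> b \<Longrightarrow>
      \<exists>v \<in> Hom C X (S \<amalg> B). (m \<oplus> Id C B) \<cdot> v = a"
    by (rule sq.mono_regular_epi_square) (rule that)
  show thesis
  proof (rule that[of "q \<cdot> inl C A B" F n])
    show "(q \<cdot> inl C A B) \<cdot> m = n \<cdot> f"
      using comp_ext[OF q(3), of "inl C S B"] q(1,2) m f by simp
    fix X a b assume ab: "a \<in> Hom C X A" "b \<in> Hom C X B" "(q \<cdot> inl C A B) \<cdot> a = n \<cdot> b"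
    \<comment> \<open>The square for \<open>m \<oplus> Id C B\<close> places \<open>a\<close> in
      \<open>S \<amalg> B\<close>; \<open>inl_lift\<close> then places it in
      \<open>S\<close>.\<close>
    have "\<exists>v \<in> Hom C X (S \<amalg> B). (m \<oplus> Id C B) \<cdot> v = inl C A B \<cdot> a"
      by (rule lift[OF _ ab(2)]) (use ab q in simp_all)
    then obtain w where w: "w \<in> Hom C X (S \<amalg> B)" "inl C A B \<cdot> a = (m \<oplus> Id C B) \<cdot> w" by metis
    show "\<exists>v \<in> Hom C X S. m \<cdot> v = a"
      by (rule inl_lift[OF m(2) \<open>B \<in> Ob C\<close> ab(1) w]) blast
  qed (use q in simp_all)
qed

text \<open>For \<open>f = m\<close>, the arrows \<open>i\<close> and \<open>n\<close> are parallel
  and agree on \<open>m\<close>; the lifting clause with \<open>a = b = h\<close> gives the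
  factorization of any \<open>h\<close> on which they agree.\<close>

lemma mono_regular:
  assumes "is_mono C m" shows "regular_mono C m"
proof -
  define S A where "S = Dom C m" and "A = Cod C m"
  have m: "m \<in> Hom C S A" using assms by (simp add: is_mono_def S_def A_def)
  obtain i n F where in_: "i \<in> Hom C A F" "n \<in> Hom C A F" "i \<cdot> m = n \<cdot> m"
    and lift: "\<And>X a b. a \<in> Hom C X A \<Longrightarrow> b \<in> Hom C X A \<Longrightarrow> i \<cdot> a = n \<cdot> b \<Longrightarrow>
      \<exists>v \<in> Hom C X S. m \<cdot> v = a"
    by (rule mono_pushout_square[OF assms m m]) (rule that)
  have "is_equalizer C m i n"
  proof (rule equalizerI[OF in_(1,2) m in_(3)])
    fix X h assume h: "h \<in> Hom C X A" "i \<cdot> h = n \<cdot> h"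
    obtain v where v: "v \<in> Hom C X S" "m \<cdot> v = h" using lift[OF h(1) h(1) h(2)] by (rule bexE)
    show "\<exists>!u. u \<in> Hom C X S \<and> m \<cdot> u = h"
    proof (intro ex1I[of _ v] conjI)
      fix u assume "u \<in> Hom C X S \<and> m \<cdot> u = h"
      then show "u = v" using mono_cancel[OF assms, of u X v] v by (simp add: S_def)
    qed (rule v)+
  qed
  then show ?thesis by (auto simp: regular_mono_def)
qed

text \<open>The comparison arrow from the pushout turns \<open>l\<close> into the monomorphism
  \<open>n\<close>, so \<open>l\<close> is itself monic.\<close>

lemma pushout_mono:
  assumes po: "is_pushout C r b t l" and r: "is_mono C r"
  shows "is_mono C l"
proof -
  interpret op: category "opp C" by (rule category_opp)
  have pb: "is_pullback (opp C) t l r b" using po by (simp add: is_pushout_def)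
  define D A B P where "D = Dom C r" and "A = Cod C r" and "B = Cod C b" and "P = Cod C t"
  have ar: "r \<in> Hom C D A" "b \<in> Hom C D B" "t \<in> Hom C A P" "l \<in> Hom C B P"
    using op.pullback_Hom[OF pb] by (simp_all add: D_def A_def B_def P_def)
  obtain i n F where F: "i \<in> Hom C A F" "n \<in> Hom C B F" "i \<cdot> r = n \<cdot> b" "is_mono C n"
    by (rule mono_pushout_square[OF r ar(1,2)])
  obtain u where "u \<in> Hom (opp C) F (Dom (opp C) t)" "t \<cdot>\<^bsub>opp C\<^esub> u = i" "l \<cdot>\<^bsub>opp C\<^esub> u = n"
    by (rule op.pullback_factor[OF pb, of i F n]) (use ar F in simp_all)
  then have u: "u \<in> Hom C P F" "u \<cdot> l = n" by (simp_all add: P_def)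
  show ?thesis
  proof (rule monoI[OF ar(4)])
    fix X f g assume fg: "f \<in> Hom C X B" "g \<in> Hom C X B" "l \<cdot> f = l \<cdot> g"
    have "n \<cdot> f = n \<cdot> g"
      using comp_ext[OF u(2), of f] comp_ext[OF u(2), of g] fg u(1) ar(4) by simp
    then show "f = g" using mono_cancel[OF F(4), of f X g] F(2) fg by simp
  qed
qed

text \<open>Colimits come from coproducts and coequalizers. Regular epimorphisms of the opposite
  category are regular monomorphisms of \<open>C\<close>, that is, all monomorphisms, and those are
  stable under pushout.\<close>

lemma coregular:
  assumes "pushouts_of_regular_epis C" shows "regular_category (opp C)"
proof -
  interpret op: category "opp C" by (rule category_opp)
  show ?thesis
  proof unfold_locales
    show "finitely_complete (opp C)"
    proof (rule op.finitely_completeI)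
      show "has_finite_products (opp C)" using coproducts by (simp add: has_finite_coproducts_def)
      fix f g A B assume "f \<in> Hom (opp C) A B" "g \<in> Hom (opp C) A B"
      then show "\<exists>e. is_equalizer (opp C) e f g"
        using coequalizer_of_pushouts[OF assms, of f B A g]
        by (simp add: is_coequalizer_def Hom_opp del: Hom_def)
    qed
    fix p q f assume "is_kernel_pair (opp C) p q f"
    then have pb: "is_pullback (opp C) p q f f" by (simp add: is_kernel_pair_def)
    have pq: "p \<in> Hom C (Cod C f) (Cod C p)" "q \<in> Hom C (Cod C f) (Cod C p)"
      using op.pullback_Hom[OF pb] by simp_all
    obtain e where "is_equalizer C e p q"
      by (rule equalizers_of_finitely_complete[OF finitely_complete pq])
    then show "\<exists>e. is_coequalizer (opp C) e p q" by (auto simp: is_coequalizer_def)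
  next
    fix t l r b assume pb: "is_pullback (opp C) t l r b" and "regular_epi (opp C) r"
    then have "regular_mono C r"
      by (simp add: regular_epi_def regular_mono_def is_coequalizer_def)
    then have "is_mono C l"
      using pushout_mono[of r b t l] pb regular_mono_mono by (simp add: is_pushout_def)
    then show "regular_epi (opp C) l"
      using mono_regular by (simp add: regular_epi_def regular_mono_def is_coequalizer_def)
  qed
qed

end

theorem corollary4p8:
  fixes C :: "('o, 'a) cat"
  assumes "exact_category C" and "condition_P C"
  shows "(\<forall>m. is_mono C m \<longrightarrow> regular_mono C m) \<and> balanced C \<and>
    (pushouts_of_regular_epis C \<longrightarrow> coregular_category C)"
proof -
  interpret exact_category C by fact
  interpret exact_condition_P C by unfold_locales fact
  show ?thesis
    using mono_regular is_iso_of_regular_mono_epi coregular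
    unfolding balanced_def coregular_category_def by blast
qed

end
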